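(* Let $G$ be a countable discrete group. The following are equivalent: (1) $G$ is amenable; (5) for every separable Hilbert space $\mathcal{H}$ and every uniformly bounded map $\varphi\colon G\to B(\mathcal{H})$, there exists a positive definite map $\psi\colon G\to B(\mathcal{H})$ such that for every finite set $F\subset G$, every integer $n\geq 1$, and every finite family of functions $\xi_1,\ldots,\xi_n,\zeta_1,\ldots,\zeta_n\colon F\to\mathcal{H}$, there exists $y\in G$ such that $$\sum_{i=1}^n\sum_{x\in F}\|\varphi(xy)\,\varphi(y)^*\,\xi_i(x)-\psi(x)\,\xi_i(x)\|^2\leq\sum_{i=1}^n\sum_{x\in F}\|\varphi(xy)\,\varphi(y)^*\,\xi_i(x)-\zeta_i(x)\|^2.$$
   Context: Hilbert spaces are complex. $B(\mathcal{H})$ denotes the algebra of bounded operators on $\mathcal{H}$ with the operator norm. A map $\varphi\colon G\to B(\mathcal{H})$ is uniformly bounded if $\sup_{x\in G}\|\varphi(x)\|<\infty$. A map $\psi\colon G\to B(\mathcal{H})$ is positive definite if $\sum_{i,j=1}^m\langle\psi(x_i^{-1}x_j)\,\xi_j,\xi_i\rangle\geq 0$ for all $m\geq 1$, $x_1,\dots,x_m\in G$ and $\xi_1,\dots,\xi_m\in\mathcal{H}$ (inner product linear in the first variable). $G$ is amenable if $\ell^\infty(G)$ admits a translation-invariant state (invariant mean). *)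

theory Defs
  imports "HOL-Analysis.Analysis" "HOL-Algebra.Algebraic_Closure_Type"
begin

section \<open>Complex Hilbert spaces on a carrier set\<close>

text \<open>
  HOL cannot quantify over types inside a formula, so ``every Hilbert space'' is rendered by
  quantifying over structures whose carrier is a subset of a type \<open>'h\<close>. If
  \<open>nat \<Rightarrow> complex\<close> injects into \<open>'h\<close>, every separable Hilbert space is isometrically
  isomorphic to such a structure: take coefficient sequences with respect to an orthonormal
  basis.
  As usual in HOL-Algebra, a module record is a ring record with a scalar multiplication; the
  fields \<open>mult\<close> and \<open>one\<close> of the space itself play no role.
\<close>

record 'h cinner_space = "(complex, 'h) module" +
  cinner :: "'h \<Rightarrow> 'h \<Rightarrow> complex"

definition hnorm :: "'h cinner_space \<Rightarrow> 'h \<Rightarrow> real"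
  where "hnorm H x = sqrt (Re (cinner H x x))"

text \<open>The value \<open>0\<close> outside the carrier serves only to meet the assumptions of
  the locale \<open>Metric_space\<close>, some of which concern the whole type.\<close>

definition hdist :: "'h cinner_space \<Rightarrow> 'h \<Rightarrow> 'h \<Rightarrow> real"
  where "hdist H x y =
    (if x \<in> carrier H \<and> y \<in> carrier H then hnorm H (x \<ominus>\<^bsub>H\<^esub> y) else 0)"

text \<open>The order on \<open>complex\<close> is the one of \<open>HOL-Library.Complex_Order\<close>:
  \<open>0 \<le> z\<close> says that \<open>z\<close> is real and nonnegative.\<close>

locale complex_inner_space =
  module "ring_of_type_algebra :: complex ring" H for H :: "'h cinner_space" (structure) +
  assumes cinner_add_left:
      "\<lbrakk>x \<in> carrier H; y \<in> carrier H; z \<in> carrier H\<rbrakk>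
        \<Longrightarrow> cinner H (x \<oplus> y) z = cinner H x z + cinner H y z"
    and cinner_smult_left:
      "\<lbrakk>x \<in> carrier H; y \<in> carrier H\<rbrakk> \<Longrightarrow> cinner H (a \<odot> x) y = a * cinner H x y"
    and cinner_commute:
      "\<lbrakk>x \<in> carrier H; y \<in> carrier H\<rbrakk> \<Longrightarrow> cinner H x y = cnj (cinner H y x)"
    and cinner_ge_zero: "x \<in> carrier H \<Longrightarrow> 0 \<le> cinner H x x"
    and cinner_eq_zero: "\<lbrakk>x \<in> carrier H; cinner H x x = 0\<rbrakk> \<Longrightarrow> x = \<zero>"

locale hilbert_space = complex_inner_space +
  assumes complete: "Metric_space.mcomplete (carrier H) (hdist H)"

locale separable_hilbert_space = hilbert_space +
  assumes separable: "separable_space (Metric_space.mtopology (carrier H) (hdist H))"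

section \<open>Bounded operators\<close>

definition bounded_operators :: "'h cinner_space \<Rightarrow> ('h \<Rightarrow> 'h) set"
  where "bounded_operators H = {T \<in> carrier H \<rightarrow>\<^sub>E carrier H.
    (\<forall>x\<in>carrier H. \<forall>y\<in>carrier H. T (x \<oplus>\<^bsub>H\<^esub> y) = T x \<oplus>\<^bsub>H\<^esub> T y) \<and>
    (\<forall>a. \<forall>x\<in>carrier H. T (a \<odot>\<^bsub>H\<^esub> x) = a \<odot>\<^bsub>H\<^esub> T x) \<and>
    (\<exists>C. \<forall>x\<in>carrier H. hnorm H (T x) \<le> C * hnorm H x)}"

definition operator_norm :: "'h cinner_space \<Rightarrow> ('h \<Rightarrow> 'h) \<Rightarrow> real"
  where "operator_norm H T = (SUP x\<in>{x \<in> carrier H. hnorm H x \<le> 1}. hnorm H (T x))"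

definition adjoint_op :: "'h cinner_space \<Rightarrow> ('h \<Rightarrow> 'h) \<Rightarrow> 'h \<Rightarrow> 'h"
  where "adjoint_op H T = (\<lambda>y\<in>carrier H. THE z. z \<in> carrier H \<and>
    (\<forall>x\<in>carrier H. cinner H (T x) y = cinner H x z))"

section \<open>Operator-valued maps on a group, and amenability\<close>

definition uniformly_bounded ::
    "('g, 'm) monoid_scheme \<Rightarrow> 'h cinner_space \<Rightarrow> ('g \<Rightarrow> 'h \<Rightarrow> 'h) \<Rightarrow> bool"
  where "uniformly_bounded G H \<phi> \<longleftrightarrow>
    bdd_above ((\<lambda>x. operator_norm H (\<phi> x)) ` carrier G)"

definition positive_definite ::
    "('g, 'm) monoid_scheme \<Rightarrow> 'h cinner_space \<Rightarrow> ('g \<Rightarrow> 'h \<Rightarrow> 'h) \<Rightarrow> bool"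
  where "positive_definite G H \<psi> \<longleftrightarrow>
    (\<forall>m\<ge>1. \<forall>x \<in> {1..m::nat} \<rightarrow> carrier G. \<forall>\<xi> \<in> {1..m} \<rightarrow> carrier H.
      0 \<le> (\<Sum>i=1..m. \<Sum>j=1..m.
             cinner H (\<psi> (inv\<^bsub>G\<^esub> (x i) \<otimes>\<^bsub>G\<^esub> x j) (\<xi> j)) (\<xi> i)))"

definition linfinity :: "('g, 'm) monoid_scheme \<Rightarrow> ('g \<Rightarrow> complex) set"
  where "linfinity G = {f \<in> extensional (carrier G). bounded (f ` carrier G)}"

definition state_on_linfinity ::
    "('g, 'm) monoid_scheme \<Rightarrow> (('g \<Rightarrow> complex) \<Rightarrow> complex) \<Rightarrow> bool"
  where "state_on_linfinity G \<mu> \<longleftrightarrow>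
    (\<forall>f\<in>linfinity G. \<forall>g\<in>linfinity G. \<mu> (\<lambda>x\<in>carrier G. f x + g x) = \<mu> f + \<mu> g) \<and>
    (\<forall>a. \<forall>f\<in>linfinity G. \<mu> (\<lambda>x\<in>carrier G. a * f x) = a * \<mu> f) \<and>
    (\<forall>f\<in>linfinity G. (\<forall>x\<in>carrier G. 0 \<le> f x) \<longrightarrow> 0 \<le> \<mu> f) \<and>
    \<mu> (\<lambda>x\<in>carrier G. 1) = 1"

text \<open>Translation invariance is taken to be invariance under left translations.\<close>

definition amenable :: "('g, 'm) monoid_scheme \<Rightarrow> bool"
  where "amenable G \<longleftrightarrow> (\<exists>\<mu>. state_on_linfinity G \<mu> \<and>
    (\<forall>s\<in>carrier G. \<forall>f\<in>linfinity G.
      \<mu> (\<lambda>x\<in>carrier G. f (inv\<^bsub>G\<^esub> s \<otimes>\<^bsub>G\<^esub> x)) = \<mu> f))"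

end

theory Submission
  imports Defs
begin

text \<open>
  If \<open>G\<close> has an invariant mean, let \<open>\<psi> x\<close> be the weak mean over \<open>y\<close> of \<open>\<phi> (x y) (\<phi> y)\<^sup>*\<close>.
  Invariance turns \<open>\<langle>\<psi> (g\<^sup>-\<^sup>1 h) \<xi>, \<eta>\<rangle>\<close> into the mean of
  \<open>\<langle>(\<phi> (h\<^sup>-\<^sup>1 y))\<^sup>* \<xi>, (\<phi> (g\<^sup>-\<^sup>1 y))\<^sup>* \<eta>\<rangle>\<close>, so \<open>\<psi>\<close> is positive definite, and the
  difference of the two sums of squares has mean \<open>- \<Sum> \<parallel>\<psi> x \<xi> - \<zeta>\<parallel>\<^sup>2 \<le> 0\<close>.

  Conversely, given bounded real functions \<open>u\<^sub>1, \<dots>, u\<^sub>m\<close>, take \<open>H = \<complex>\<^sup>m\<^sup>+\<^sup>1\<close>,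
  \<open>v y = e\<^sub>0 + \<Sum> u\<^sub>k y e\<^sub>k\<close> and \<open>\<phi> y \<xi> = \<langle>\<xi>, e\<^sub>0\<rangle> v y\<close>. The approximation property puts \<open>\<psi>\<close>
  in the closed convex hull of the \<open>x \<mapsto> \<phi> (x y) (\<phi> y)\<^sup>*\<close>, and the relation
  \<open>\<psi> (x\<^sup>-\<^sup>1) = (\<psi> x)\<^sup>*\<close> between the entries \<open>(k, 0)\<close> and \<open>(0, k)\<close> says that \<open>u\<^sub>k (x \<cdot>)\<close> and
  \<open>u\<^sub>k\<close> have the same mean. Hence no finite sum of functions \<open>u (s \<cdot>) - u\<close> is bounded below by a
  positive constant, and the Hahn-Banach theorem yields an invariant mean.
\<close>

section \<open>Complex inner product spaces on a carrier\<close>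

text \<open>Turns the scalar ring of the module locale into ordinary arithmetic on the type, so that
  the module axioms simplify to statements about complex numbers.\<close>

lemma carrier_ring_of_type_algebra [simp]: "carrier (ring_of_type_algebra :: 'a::ring_1 ring) = UNIV"
  and one_ring_of_type_algebra [simp]: "\<one>\<^bsub>ring_of_type_algebra\<^esub> = (1 :: 'a)"
  and zero_ring_of_type_algebra [simp]: "\<zero>\<^bsub>ring_of_type_algebra\<^esub> = (0 :: 'a)"
  and add_ring_of_type_algebra [simp]: "a \<oplus>\<^bsub>ring_of_type_algebra\<^esub> b = (a + b :: 'a)"
  and mult_ring_of_type_algebra [simp]: "a \<otimes>\<^bsub>ring_of_type_algebra\<^esub> b = (a * b :: 'a)"
  by (simp_all add: ring_of_type_algebra_def)

context complex_inner_space
begin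

lemma smult_in_carrier [simp, intro]: "x \<in> carrier H \<Longrightarrow> a \<odot> x \<in> carrier H"
  using smult_closed by simp

lemma cinner_add_right:
  assumes "x \<in> carrier H" "y \<in> carrier H" "z \<in> carrier H"
  shows "cinner H z (x \<oplus> y) = cinner H z x + cinner H z y"
  using assms cinner_commute[of z] by (simp add: cinner_add_left)

lemma cinner_smult_right:
  assumes "x \<in> carrier H" "y \<in> carrier H"
  shows "cinner H x (a \<odot> y) = cnj a * cinner H x y"
  using assms cinner_commute[of x] by (simp add: cinner_smult_left)

lemma cinner_zero_left [simp]:
  assumes "x \<in> carrier H"
  shows "cinner H \<zero> x = 0"
  using cinner_add_left[of \<zero> \<zero> x] assms by simp

lemma cinner_zero_right [simp]: "x \<in> carrier H \<Longrightarrow> cinner H x \<zero> = 0"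
  using cinner_commute[of x \<zero>] by simp

lemma cinner_minus_left:
  assumes "x \<in> carrier H" "y \<in> carrier H" "z \<in> carrier H"
  shows "cinner H (x \<ominus> y) z = cinner H x z - cinner H y z"
proof -
  have "(x \<ominus> y) \<oplus> y = x"
    using assms by (simp add: a_minus_def M.a_assoc M.l_neg)
  then show ?thesis
    using cinner_add_left[of "x \<ominus> y" y z] assms by (simp add: algebra_simps)
qed

lemma cinner_minus_right:
  assumes "x \<in> carrier H" "y \<in> carrier H" "z \<in> carrier H"
  shows "cinner H z (x \<ominus> y) = cinner H z x - cinner H z y"
  using assms cinner_commute[of z] by (simp add: cinner_minus_left)

lemma hnorm_nonneg [simp]: "x \<in> carrier H \<Longrightarrow> 0 \<le> hnorm H x"
  using cinner_ge_zero[of x] by (simp add: hnorm_def less_eq_complex_def)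

lemma cinner_self: "x \<in> carrier H \<Longrightarrow> cinner H x x = of_real ((hnorm H x)\<^sup>2)"
  using cinner_ge_zero[of x] by (simp add: hnorm_def less_eq_complex_def complex_eq_iff)

lemma hnorm_power2: "x \<in> carrier H \<Longrightarrow> (hnorm H x)\<^sup>2 = Re (cinner H x x)"
  by (simp add: cinner_self)

lemma hnorm_eq_0_iff:
  assumes "x \<in> carrier H"
  shows "hnorm H x = 0 \<longleftrightarrow> x = \<zero>"
proof
  assume "hnorm H x = 0"
  then have "cinner H x x = 0"
    using assms by (simp add: cinner_self)
  with assms show "x = \<zero>"
    by (rule cinner_eq_zero)
qed (simp add: hnorm_def)

lemma Re_cinner_commute:
  "x \<in> carrier H \<Longrightarrow> y \<in> carrier H \<Longrightarrow> Re (cinner H x y) = Re (cinner H y x)"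
  using cinner_commute[of x y] by simp

lemma hnorm_add_power2:
  assumes "x \<in> carrier H" "y \<in> carrier H"
  shows "(hnorm H (x \<oplus> y))\<^sup>2 = (hnorm H x)\<^sup>2 + 2 * Re (cinner H x y) + (hnorm H y)\<^sup>2"
  using assms Re_cinner_commute[of x y]
  by (simp add: hnorm_power2 cinner_add_left cinner_add_right)

lemma hnorm_minus_power2:
  assumes "x \<in> carrier H" "y \<in> carrier H"
  shows "(hnorm H (x \<ominus> y))\<^sup>2 = (hnorm H x)\<^sup>2 - 2 * Re (cinner H x y) + (hnorm H y)\<^sup>2"
  using assms Re_cinner_commute[of x y]
  by (simp add: hnorm_power2 cinner_minus_left cinner_minus_right)

lemma hnorm_smult:
  assumes "x \<in> carrier H"
  shows "hnorm H (a \<odot> x) = cmod a * hnorm H x"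
proof -
  have "cinner H (a \<odot> x) (a \<odot> x) = a * (cnj a * of_real ((hnorm H x)\<^sup>2))"
    using assms by (simp add: cinner_smult_left cinner_smult_right cinner_self[of x])
  then have "(hnorm H (a \<odot> x))\<^sup>2 = Re (a * (cnj a * of_real ((hnorm H x)\<^sup>2)))"
    using assms by (simp add: hnorm_power2[of "a \<odot> x"])
  also have "\<dots> = (cmod a * hnorm H x)\<^sup>2"
    by (simp add: cmod_power2 power_mult_distrib) (simp add: power2_eq_square algebra_simps)
  finally have "(hnorm H (a \<odot> x))\<^sup>2 = (cmod a * hnorm H x)\<^sup>2" .
  then show ?thesis
    using assms by (simp add: power2_eq_iff_nonneg)
qed

lemma cinner_Cauchy_Schwarz:
  assumes [simp]: "x \<in> carrier H" "y \<in> carrier H"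
  shows "cmod (cinner H x y) \<le> hnorm H x * hnorm H y"
proof (cases "hnorm H y = 0")
  case True
  then show ?thesis by (simp add: hnorm_eq_0_iff)
next
  case False
  then have pos: "hnorm H y > 0"
    using hnorm_nonneg[OF assms(2)] by linarith
  define w where "w = cinner H x y"
  \<comment> \<open>\<open>a \<odot> y\<close> is the orthogonal projection of \<open>x\<close> onto
    the line of \<open>y\<close>; the inequality says that the squared norm of
    \<open>x \<ominus> a \<odot> y\<close> is nonnegative.\<close>
  define a where "a = w / of_real ((hnorm H y)\<^sup>2)"
  have "Re (cinner H x (a \<odot> y)) = Re (w * cnj w / of_real ((hnorm H y)\<^sup>2))"
    by (simp add: cinner_smult_right a_def w_def[symmetric] mult.commute del: of_real_power)
  also have "\<dots> = (cmod w)\<^sup>2 / (hnorm H y)\<^sup>2"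
    unfolding complex_norm_square[symmetric] of_real_divide[symmetric] by (rule Re_complex_of_real)
  finally have "Re (cinner H x (a \<odot> y)) = (cmod w)\<^sup>2 / (hnorm H y)\<^sup>2" .
  moreover have "cmod a = cmod w / (hnorm H y)\<^sup>2"
    by (simp add: a_def norm_divide norm_power)
  then have "(hnorm H (a \<odot> y))\<^sup>2 = (cmod w)\<^sup>2 / (hnorm H y)\<^sup>2"
    using pos by (simp add: hnorm_smult power2_eq_square)
  ultimately have "0 \<le> (hnorm H x)\<^sup>2 - (cmod w)\<^sup>2 / (hnorm H y)\<^sup>2"
    using hnorm_minus_power2[of x "a \<odot> y"] zero_le_power2[of "hnorm H (x \<ominus> a \<odot> y)"] by simp
  then have "(cmod w)\<^sup>2 \<le> (hnorm H x * hnorm H y)\<^sup>2"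
    using pos by (simp add: pos_divide_le_eq power_mult_distrib)
  then show ?thesis
    unfolding w_def by (rule power2_le_imp_le) simp
qed

lemma hnorm_triangle:
  assumes "x \<in> carrier H" "y \<in> carrier H"
  shows "hnorm H (x \<oplus> y) \<le> hnorm H x + hnorm H y"
proof (rule power2_le_imp_le)
  have "Re (cinner H x y) \<le> hnorm H x * hnorm H y"
    using cinner_Cauchy_Schwarz[OF assms] complex_Re_le_cmod order_trans by blast
  then show "(hnorm H (x \<oplus> y))\<^sup>2 \<le> (hnorm H x + hnorm H y)\<^sup>2"
    using assms by (simp add: hnorm_add_power2 power2_sum)
qed (use assms in simp)

lemma minus_eq_zero_iff [simp]:
  assumes "x \<in> carrier H" "y \<in> carrier H"
  shows "x \<ominus> y = \<zero> \<longleftrightarrow> x = y"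
proof -
  have "(x \<ominus> y) \<oplus> y = x"
    using assms by (simp add: a_minus_def M.a_assoc M.l_neg)
  then show ?thesis
    using assms M.r_neg[of x] by (auto simp: a_minus_def)
qed

text \<open>The working extensionality principle for vectors: an identity in the carrier becomes,
  after pairing with an arbitrary \<open>z\<close>, an identity of complex numbers that the
  simplifier can settle.\<close>

lemma cinner_eqI:
  assumes "x \<in> carrier H" "y \<in> carrier H" "\<And>z. z \<in> carrier H \<Longrightarrow> cinner H z x = cinner H z y"
  shows "x = y"
proof -
  have "cinner H (x \<ominus> y) (x \<ominus> y) = 0"
    using assms by (simp add: cinner_minus_right)
  then have "x \<ominus> y = \<zero>"
    using assms by (intro cinner_eq_zero) auto
  then show ?thesis
    using assms by simp
qed

lemma hnorm_minus_commute:
  assumes "x \<in> carrier H" "y \<in> carrier H"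
  shows "hnorm H (x \<ominus> y) = hnorm H (y \<ominus> x)"
proof -
  have "(hnorm H (x \<ominus> y))\<^sup>2 = (hnorm H (y \<ominus> x))\<^sup>2"
    using assms Re_cinner_commute[of x y] by (simp add: hnorm_minus_power2)
  then show ?thesis
    using assms by (simp add: power2_eq_iff_nonneg)
qed

sublocale hmetric: Metric_space "carrier H" "hdist H"
proof
  fix x y z
  show "0 \<le> hdist H x y"
    by (simp add: hdist_def)
  show "hdist H x y = hdist H y x"
    by (simp add: hdist_def hnorm_minus_commute)
  assume [simp]: "x \<in> carrier H" "y \<in> carrier H"
  show "(hdist H x y = 0) = (x = y)"
    by (simp add: hdist_def hnorm_eq_0_iff)
  assume [simp]: "z \<in> carrier H"
  have "x \<ominus> z = (x \<ominus> y) \<oplus> (y \<ominus> z)"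
    by (rule cinner_eqI) (simp_all add: cinner_minus_right cinner_add_right)
  then show "hdist H x z \<le> hdist H x y + hdist H y z"
    using hnorm_triangle[of "x \<ominus> y" "y \<ominus> z"] by (simp add: hdist_def)
qed

end

section \<open>Bounded operators and the Riesz representation\<close>

lemma bounded_operator_closed [simp, intro]:
  "T \<in> bounded_operators H \<Longrightarrow> x \<in> carrier H \<Longrightarrow> T x \<in> carrier H"
  by (auto simp: bounded_operators_def)

lemma bounded_operator_add:
  "T \<in> bounded_operators H \<Longrightarrow> x \<in> carrier H \<Longrightarrow> y \<in> carrier H \<Longrightarrow>
    T (x \<oplus>\<^bsub>H\<^esub> y) = T x \<oplus>\<^bsub>H\<^esub> T y"
  by (auto simp: bounded_operators_def)

lemma bounded_operator_smult:
  "T \<in> bounded_operators H \<Longrightarrow> x \<in> carrier H \<Longrightarrow> T (a \<odot>\<^bsub>H\<^esub> x) = a \<odot>\<^bsub>H\<^esub> T x"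
  by (auto simp: bounded_operators_def)

context complex_inner_space
begin

text \<open>A nonzero vector is scaled to norm 1, where the supremum defining
  \<open>operator_norm\<close> applies; at zero, additivity alone forces the value zero.\<close>

lemma hnorm_le_operator_norm:
  assumes T: "T \<in> bounded_operators H" and x: "x \<in> carrier H"
  shows "hnorm H (T x) \<le> operator_norm H T * hnorm H x"
proof (cases "x = \<zero>")
  case True
  have "T \<zero> \<oplus> T \<zero> = T \<zero>"
    using bounded_operator_add[OF T, of \<zero> \<zero>] by simp
  then have "T \<zero> = \<zero>"
    using T by (metis M.add.l_cancel_one' M.zero_closed bounded_operator_closed)
  then show ?thesis
    using True hnorm_eq_0_iff[of \<zero>] by simp
next
  case False
  define r where "r = hnorm H x"
  have r: "r > 0"
    using False x hnorm_nonneg[OF x] hnorm_eq_0_iff[OF x] unfolding r_def by linarith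
  obtain C where C: "\<And>x. x \<in> carrier H \<Longrightarrow> hnorm H (T x) \<le> C * hnorm H x"
    using T unfolding bounded_operators_def by blast
  have "hnorm H (T y) \<le> \<bar>C\<bar>" if "y \<in> carrier H" "hnorm H y \<le> 1" for y
  proof -
    have "C * hnorm H y \<le> \<bar>C\<bar> * 1"
      using that by (intro mult_mono) auto
    then show ?thesis
      using C[OF that(1)] by simp
  qed
  \<comment> \<open>A supremum of reals bounds its members only once the set is known to be bounded
    above, which is where boundedness of \<open>T\<close> enters.\<close>
  then have "bdd_above ((\<lambda>x. hnorm H (T x)) ` {x \<in> carrier H. hnorm H x \<le> 1})"
    by (intro bdd_aboveI[of _ "\<bar>C\<bar>"]) auto
  moreover have "hnorm H (of_real (1 / r) \<odot> x) \<le> 1"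
    using r by (simp add: hnorm_smult x norm_divide) (simp add: r_def)
  ultimately have "hnorm H (T (of_real (1 / r) \<odot> x)) \<le> operator_norm H T"
    unfolding operator_norm_def using x by (intro cSUP_upper) auto
  moreover have "hnorm H (T (of_real (1 / r) \<odot> x)) = hnorm H (T x) / r"
    using r T x by (simp add: bounded_operator_smult hnorm_smult norm_divide)
  ultimately show ?thesis
    using r by (simp add: pos_divide_le_eq r_def)
qed

text \<open>Nondegeneracy of the inner product makes the description in \<open>adjoint_op\<close>
  unique, so exhibiting one suitable vector determines its value.\<close>

lemma adjoint_op_eqI:
  assumes "y \<in> carrier H" "z \<in> carrier H"
    and "\<And>x. x \<in> carrier H \<Longrightarrow> cinner H (T x) y = cinner H x z"
  shows "adjoint_op H T y = z"
proof -
  have "(THE z. z \<in> carrier H \<and> (\<forall>x\<in>carrier H. cinner H (T x) y = cinner H x z)) = z"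
  proof (rule the_equality)
    fix z' assume "z' \<in> carrier H \<and> (\<forall>x\<in>carrier H. cinner H (T x) y = cinner H x z')"
    then show "z' = z"
      using assms by (intro cinner_eqI) auto
  qed (use assms in auto)
  then show ?thesis
    using assms(1) by (simp add: adjoint_op_def)
qed

text \<open>The double sum is the inner product of \<open>s\<close> with itself, where
  \<open>s\<close> is the sum of all \<open>c i\<close>. The proof builds \<open>s\<close> by
  induction and knows it only through its inner products.\<close>

lemma sum_cinner_pairs_nonneg:
  assumes "finite I" "\<And>i. i \<in> I \<Longrightarrow> c i \<in> carrier H"
  shows "0 \<le> (\<Sum>i\<in>I. \<Sum>j\<in>I. cinner H (c j) (c i))"
proof -
  have "\<exists>s\<in>carrier H. \<forall>z\<in>carrier H. cinner H s z = (\<Sum>j\<in>I. cinner H (c j) z)"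
    using assms
  proof (induction I rule: finite_induct)
    case empty
    show ?case by (intro bexI[of _ \<zero>]) auto
  next
    case (insert k I)
    then obtain s where s: "s \<in> carrier H" "\<And>z. z \<in> carrier H \<Longrightarrow> cinner H s z = (\<Sum>j\<in>I. cinner H (c j) z)"
      by auto
    then show ?case
      using insert by (intro bexI[of _ "c k \<oplus> s"]) (auto simp: cinner_add_left)
  qed
  then obtain s where s: "s \<in> carrier H" "\<And>z. z \<in> carrier H \<Longrightarrow> cinner H s z = (\<Sum>j\<in>I. cinner H (c j) z)"
    by auto
  have "(\<Sum>i\<in>I. \<Sum>j\<in>I. cinner H (c j) (c i)) = (\<Sum>i\<in>I. cinner H s (c i))"
    using s assms by simp
  also have "\<dots> = (\<Sum>i\<in>I. cnj (cinner H (c i) s))"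
    using s assms by (intro sum.cong refl cinner_commute) auto
  also have "\<dots> = cnj (cinner H s s)"
    using s by (simp add: cnj_sum)
  also have "\<dots> = cinner H s s"
    using cinner_commute[OF s(1) s(1)] by simp
  finally show ?thesis
    using cinner_ge_zero[OF s(1)] by simp
qed

end

section \<open>Riesz representation and adjoints\<close>

context hilbert_space
begin

text \<open>The representing vector minimises \<open>J z = \<parallel>z\<parallel>\<^sup>2 - 2 Re (h z)\<close>: a minimising
  sequence is Cauchy by the parallelogram law.\<close>

lemma Riesz_representation:
  assumes h_add: "\<And>x y. x \<in> carrier H \<Longrightarrow> y \<in> carrier H \<Longrightarrow> h (x \<oplus> y) = h x + h y"
    and h_smult: "\<And>a x. x \<in> carrier H \<Longrightarrow> h (a \<odot> x) = a * h x"
    and h_bound: "\<And>x. x \<in> carrier H \<Longrightarrow> cmod (h x) \<le> C * hnorm H x"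
  obtains z where "z \<in> carrier H" "\<And>x. x \<in> carrier H \<Longrightarrow> h x = cinner H x z"
proof -
  \<comment> \<open>If \<open>z0\<close> represents \<open>h\<close>, then \<open>J z\<close> is the
    squared distance from \<open>z\<close> to \<open>z0\<close> minus the squared norm of
    \<open>z0\<close>, so the representing vector is the minimiser.\<close>
  define J where "J z = (hnorm H z)\<^sup>2 - 2 * Re (h z)" for z
  define m where "m = (INF z\<in>carrier H. J z)"
  have "J z \<ge> - C\<^sup>2" if "z \<in> carrier H" for z
  proof -
    have "Re (h z) \<le> C * hnorm H z"
      using h_bound[OF that] complex_Re_le_cmod order_trans by blast
    \<comment> \<open>Completing the square against the bound \<open>C\<close> shows that the
      infimum of \<open>J\<close> is finite.\<close>
    moreover have "(hnorm H z - C)\<^sup>2 \<ge> 0"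
      by simp
    ultimately show ?thesis
      unfolding J_def power2_diff by (simp add: algebra_simps)
  qed
  then have bdd: "bdd_below (J ` carrier H)"
    by (intro bdd_belowI[of _ "- C\<^sup>2"]) auto
  have m_le: "m \<le> J z" if "z \<in> carrier H" for z
    unfolding m_def using bdd that by (rule cINF_lower)
  have J_add: "J (z \<oplus> w) = J z + 2 * Re (cinner H w z - h w) + (hnorm H w)\<^sup>2"
    if "z \<in> carrier H" "w \<in> carrier H" for z w
    using that Re_cinner_commute[of z w] by (simp add: J_def hnorm_add_power2 h_add)
  have "\<exists>z\<in>carrier H. J z < m + 1 / Suc k" for k :: nat
  proof -
    have "carrier H \<noteq> {}" "m < m + 1 / Suc k"
      by auto
    then show ?thesis
      unfolding m_def using cINF_less_iff[OF _ bdd] by metis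
  qed
  then obtain s where s [simp]: "\<And>k. s k \<in> carrier H" and sJ: "\<And>k. J (s k) < m + 1 / Suc k"
    by metis
  have s_close: "(hnorm H (s l \<ominus> s k))\<^sup>2 \<le> 2 * (1 / Suc k + 1 / Suc l)" for k l
  proof -
    define d where "d = s l \<ominus> s k"
    define b where "b = Re (cinner H d (s k) - h d)"
    have d: "d \<in> carrier H"
      by (simp add: d_def)
    have "s k \<oplus> d = s l"
      unfolding d_def by (rule cinner_eqI) (simp_all add: cinner_minus_right cinner_add_right)
    then have "J (s l) = J (s k) + 2 * b + (hnorm H d)\<^sup>2"
      using J_add[OF s[of k] d] by (simp add: b_def)
    \<comment> \<open>\<open>J\<close> is tested at the midpoint of \<open>s k\<close> and
      \<open>s l\<close>. Eliminating the linear term \<open>b\<close> between the two relations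
      leaves the parallelogram estimate for \<open>d\<close>.\<close>
    moreover have "m \<le> J (s k) + b + (hnorm H d)\<^sup>2 / 4"
      using m_le[of "s k \<oplus> (1/2) \<odot> d"] J_add[OF s, of "(1/2) \<odot> d"] d
      by (simp add: b_def cinner_smult_left h_smult hnorm_smult power2_eq_square)
    ultimately have "(hnorm H d)\<^sup>2 \<le> 2 * (J (s k) - m + (J (s l) - m))"
      by simp
    then show ?thesis
      using sJ[of k] sJ[of l] by (simp add: d_def)
  qed
  have "hmetric.MCauchy s"
    unfolding hmetric.MCauchy_def
  proof (intro conjI allI impI)
    fix \<epsilon> :: real assume "\<epsilon> > 0"
    then obtain N :: nat where N: "4 / \<epsilon>\<^sup>2 < real N"
      using reals_Archimedean2 by blast
    have "hdist H (s k) (s l) < \<epsilon>" if "N \<le> k" "N \<le> l" for k l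
    proof -
      have "1 / real (Suc k) \<le> 1 / real (Suc N)" "1 / real (Suc l) \<le> 1 / real (Suc N)"
        using that by (simp_all add: frac_le)
      moreover have "4 / real (Suc N) < \<epsilon>\<^sup>2"
      proof -
        have "4 < \<epsilon>\<^sup>2 * real N"
          using N \<open>\<epsilon> > 0\<close> by (simp add: pos_divide_less_eq mult.commute)
        also have "\<dots> \<le> \<epsilon>\<^sup>2 * real (Suc N)"
          by (intro mult_left_mono) auto
        finally show ?thesis
          by (simp add: pos_divide_less_eq)
      qed
      ultimately have "(hnorm H (s k \<ominus> s l))\<^sup>2 < \<epsilon>\<^sup>2"
        using s_close[of k l] by simp
      then show ?thesis
        using \<open>\<epsilon> > 0\<close> by (simp add: hdist_def power_less_imp_less_base)
    qed
    then show "\<exists>N. \<forall>k l. N \<le> k \<longrightarrow> N \<le> l \<longrightarrow> hdist H (s k) (s l) < \<epsilon>"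
      by blast
  qed auto
  then obtain z where "limitin hmetric.mtopology s z sequentially"
    using complete hmetric.mcomplete_def by blast
  then have z [simp]: "z \<in> carrier H" and lim: "(\<lambda>k. hnorm H (s k \<ominus> z)) \<longlonglongrightarrow> 0"
    by (auto simp: hmetric.limit_metric_sequentially hdist_def LIMSEQ_iff)
  have "h x = cinner H x z" if x: "x \<in> carrier H" for x
  proof -
    define w where "w = cinner H x z - h x"
    define r where "r = (hnorm H x)\<^sup>2"
    have lim_x: "(\<lambda>k. cinner H x (s k)) \<longlonglongrightarrow> cinner H x z"
    proof (rule LIM_zero_cancel, rule Lim_null_comparison)
      show "(\<lambda>k. hnorm H x * hnorm H (s k \<ominus> z)) \<longlonglongrightarrow> 0"
        using tendsto_mult_left[OF lim] by simp
      show "\<forall>\<^sub>F k in sequentially. cmod (cinner H x (s k) - cinner H x z) \<le> hnorm H x * hnorm H (s k \<ominus> z)"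
        using x cinner_Cauchy_Schwarz[OF x, of "s _ \<ominus> z"] by (simp add: cinner_minus_right)
    qed
    \<comment> \<open>First-order condition at \<open>z\<close>: moving \<open>s k\<close> by
      \<open>t \<odot> x\<close> cannot lower \<open>J\<close> by more than
      \<open>1 / Suc k\<close>, and the inequality passes to the limit.\<close>
    have var: "0 \<le> 2 * Re (t * w) + (cmod t)\<^sup>2 * r" for t
    proof (rule LIMSEQ_le_const)
      show "(\<lambda>k. 1 / real (Suc k) + 2 * Re (t * (cinner H x (s k) - h x)) + (cmod t)\<^sup>2 * r)
          \<longlonglongrightarrow> 2 * Re (t * w) + (cmod t)\<^sup>2 * r"
        unfolding w_def by (rule tendsto_eq_intros lim_x LIMSEQ_Suc[OF lim_1_over_n] refl | simp)+
      have "0 \<le> 1 / real (Suc k) + 2 * Re (t * (cinner H x (s k) - h x)) + (cmod t)\<^sup>2 * r" for k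
        using m_le[of "s k \<oplus> t \<odot> x"] J_add[OF s, of "t \<odot> x" k] sJ[of k] x
        by (simp add: cinner_smult_left h_smult hnorm_smult r_def power_mult_distrib algebra_simps)
      then show "\<exists>N. \<forall>k\<ge>N. 0 \<le> 1 / real (Suc k) + 2 * Re (t * (cinner H x (s k) - h x)) + (cmod t)\<^sup>2 * r"
        by blast
    qed
    have "w = 0"
    proof (rule ccontr)
      assume "w \<noteq> 0"
      \<comment> \<open>With \<open>t = - \<tau> * cnj w\<close> the linear term of
        \<open>var\<close> becomes a negative multiple of the squared modulus of \<open>w\<close>;
        \<open>\<tau> * r < 1\<close> keeps the quadratic term from compensating it.\<close>
      define \<tau> where "\<tau> = 1 / (r + 1)"
      have r: "r \<ge> 0"
        by (simp add: r_def)
      then have \<tau>: "\<tau> > 0" "\<tau> * r < 1"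
        by (auto simp: \<tau>_def)
      have "Re (- of_real \<tau> * cnj w * w) = - \<tau> * (cmod w)\<^sup>2"
        by (simp add: cmod_power2) (simp add: power2_eq_square algebra_simps)
      moreover have "(cmod (- of_real \<tau> * cnj w))\<^sup>2 = \<tau>\<^sup>2 * (cmod w)\<^sup>2"
        by (simp add: norm_mult power_mult_distrib)
      ultimately have "0 \<le> \<tau> * (cmod w)\<^sup>2 * (\<tau> * r - 2)"
        using var[of "- of_real \<tau> * cnj w"] by (simp add: power2_eq_square algebra_simps)
      moreover have "\<tau> * (cmod w)\<^sup>2 * (\<tau> * r - 2) < 0"
        using \<tau> \<open>w \<noteq> 0\<close> by (intro mult_pos_neg) auto
      ultimately show False by simp
    qed
    then show ?thesis
      by (simp add: w_def)
  qed
  then show ?thesis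
    using that z by blast
qed

text \<open>Riesz representation of the functional that sends \<open>x\<close> to
  \<open>cinner H (T x) y\<close>, which is bounded by Cauchy-Schwarz and the operator norm of
  \<open>T\<close>.\<close>

lemma
  assumes T: "T \<in> bounded_operators H" and y: "y \<in> carrier H"
  shows adjoint_op_closed [simp, intro]: "adjoint_op H T y \<in> carrier H"
    and cinner_adjoint_op: "x \<in> carrier H \<Longrightarrow> cinner H (T x) y = cinner H x (adjoint_op H T y)"
proof -
  have "cmod (cinner H (T x) y) \<le> (operator_norm H T * hnorm H y) * hnorm H x"
    if "x \<in> carrier H" for x
    using cinner_Cauchy_Schwarz[of "T x" y] hnorm_le_operator_norm[OF T that] T y that
      mult_right_mono[of "hnorm H (T x)" "operator_norm H T * hnorm H x" "hnorm H y"]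
    by (simp add: mult_ac)
  then obtain z where z: "z \<in> carrier H" "\<And>x. x \<in> carrier H \<Longrightarrow> cinner H (T x) y = cinner H x z"
    using Riesz_representation[of "\<lambda>x. cinner H (T x) y" "operator_norm H T * hnorm H y"] T y
    by (auto simp: bounded_operator_add bounded_operator_smult cinner_add_left cinner_smult_left)
  then have "adjoint_op H T y = z"
    using y by (intro adjoint_op_eqI)
  with z show "adjoint_op H T y \<in> carrier H"
    and "x \<in> carrier H \<Longrightarrow> cinner H (T x) y = cinner H x (adjoint_op H T y)"
    by auto
qed

lemma adjoint_op_add:
  assumes T: "T \<in> bounded_operators H" and [simp]: "y \<in> carrier H" "z \<in> carrier H"
  shows "adjoint_op H T (y \<oplus> z) = adjoint_op H T y \<oplus> adjoint_op H T z"
  using T by (intro adjoint_op_eqI) (auto simp: cinner_add_right simp flip: cinner_adjoint_op)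

lemma adjoint_op_smult:
  assumes T: "T \<in> bounded_operators H" and [simp]: "y \<in> carrier H"
  shows "adjoint_op H T (a \<odot> y) = a \<odot> adjoint_op H T y"
  using T by (intro adjoint_op_eqI) (auto simp: cinner_smult_right simp flip: cinner_adjoint_op)

text \<open>With \<open>z\<close> the adjoint applied to \<open>y\<close>, the squared norm of
  \<open>z\<close> is \<open>Re (cinner H (T z) y)\<close>, at most
  \<open>K * hnorm H z * hnorm H y\<close>; one factor \<open>hnorm H z\<close> cancels.\<close>

lemma hnorm_adjoint_op_le:
  assumes T: "T \<in> bounded_operators H" and y: "y \<in> carrier H"
    and K: "\<And>x. x \<in> carrier H \<Longrightarrow> hnorm H (T x) \<le> K * hnorm H x"
  shows "hnorm H (adjoint_op H T y) \<le> K * hnorm H y"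
proof -
  define z where "z = adjoint_op H T y"
  have z: "z \<in> carrier H"
    using T y by (simp add: z_def)
  have "(hnorm H z)\<^sup>2 = Re (cinner H (T z) y)"
    using cinner_adjoint_op[OF T y z] hnorm_power2[OF z] by (simp add: z_def)
  also have "\<dots> \<le> hnorm H (T z) * hnorm H y"
    using cinner_Cauchy_Schwarz[of "T z" y] T y z complex_Re_le_cmod order_trans by blast
  also have "\<dots> \<le> K * hnorm H z * hnorm H y"
    using K[OF z] y by (intro mult_right_mono) auto
  finally have le: "hnorm H z * hnorm H z \<le> hnorm H z * (K * hnorm H y)"
    by (simp add: power2_eq_square mult_ac)
  show ?thesis
  proof (cases "hnorm H z > 0")
    case True
    with le show ?thesis
      by (simp add: z_def)
  next
    case False
    \<comment> \<open>The sign of \<open>K\<close> is not assumed; the bound applied to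
      \<open>y\<close> itself supplies what is needed when \<open>z\<close> has norm zero.\<close>
    have "0 \<le> K * hnorm H y"
      using K[OF y] hnorm_nonneg[of "T y"] T y by (meson bounded_operator_closed order_trans)
    with False show ?thesis
      by (simp add: z_def)
  qed
qed

end

section \<open>States on bounded functions\<close>

locale linfinity_state =
  fixes G :: "('g, 'm) monoid_scheme" and \<mu> :: "('g \<Rightarrow> complex) \<Rightarrow> complex"
  assumes state: "state_on_linfinity G \<mu>"
begin

definition bounded_fun :: "('g \<Rightarrow> complex) \<Rightarrow> bool"
  where "bounded_fun f \<longleftrightarrow> bounded (f ` carrier G)"

text \<open>Members of \<open>linfinity\<close> are extensional; restricting first allows
  \<open>mean\<close> to be applied to any lambda term, whatever its values off the carrier.\<close>

definition mean :: "('g \<Rightarrow> complex) \<Rightarrow> complex"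
  where "mean f = \<mu> (restrict f (carrier G))"

lemma restrict_in_linfinity: "bounded_fun f \<Longrightarrow> restrict f (carrier G) \<in> linfinity G"
  by (simp add: linfinity_def bounded_fun_def)

lemma bounded_funI: "(\<And>y. y \<in> carrier G \<Longrightarrow> cmod (f y) \<le> B) \<Longrightarrow> bounded_fun f"
  by (auto simp: bounded_fun_def bounded_iff)

lemma bounded_fun_iff: "bounded_fun f \<longleftrightarrow> (\<exists>B. \<forall>y\<in>carrier G. cmod (f y) \<le> B)"
  by (auto simp: bounded_fun_def bounded_iff)

lemma bounded_fun_const [simp, intro]: "bounded_fun (\<lambda>y. c)"
  by (rule bounded_funI[of _ "cmod c"]) simp

lemma bounded_fun_add [simp, intro]:
  assumes "bounded_fun f" "bounded_fun g"
  shows "bounded_fun (\<lambda>y. f y + g y)"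
  using assms unfolding bounded_fun_def by (rule bounded_plus_comp)

lemma bounded_fun_mult [simp, intro]:
  assumes "bounded_fun f"
  shows "bounded_fun (\<lambda>y. c * f y)"
proof -
  obtain B where "\<forall>y\<in>carrier G. cmod (f y) \<le> B"
    using assms by (auto simp: bounded_fun_iff)
  then show ?thesis
    by (intro bounded_funI[of _ "cmod c * B"]) (simp add: norm_mult mult_left_mono)
qed

lemma bounded_fun_cnj [simp, intro]: "bounded_fun f \<Longrightarrow> bounded_fun (\<lambda>y. cnj (f y))"
  by (simp add: bounded_fun_def bounded_iff)

lemma bounded_fun_sum [simp, intro]:
  "(\<And>i. i \<in> I \<Longrightarrow> bounded_fun (f i)) \<Longrightarrow> bounded_fun (\<lambda>y. \<Sum>i\<in>I. f i y)"
  by (induction I rule: infinite_finite_induct) auto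

lemma bounded_fun_Re [simp, intro]:
  assumes "bounded_fun f"
  shows "bounded_fun (\<lambda>y. of_real (Re (f y)))"
proof -
  obtain B where "\<forall>y\<in>carrier G. cmod (f y) \<le> B"
    using assms by (auto simp: bounded_fun_iff)
  then show ?thesis
    by (intro bounded_funI[of _ B]) (auto intro: order_trans[OF abs_Re_le_cmod])
qed

lemma mean_cong: "(\<And>y. y \<in> carrier G \<Longrightarrow> f y = g y) \<Longrightarrow> mean f = mean g"
  unfolding mean_def by (metis restrict_ext)

lemma mean_add:
  assumes "bounded_fun f" "bounded_fun g"
  shows "mean (\<lambda>y. f y + g y) = mean f + mean g"
proof -
  have "\<mu> (\<lambda>y\<in>carrier G. restrict f (carrier G) y + restrict g (carrier G) y) = mean f + mean g"
    using state assms restrict_in_linfinity unfolding state_on_linfinity_def mean_def by blast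
  also have "(\<lambda>y\<in>carrier G. restrict f (carrier G) y + restrict g (carrier G) y) = (\<lambda>y\<in>carrier G. f y + g y)"
    by (rule restrict_ext) simp
  finally show ?thesis
    unfolding mean_def .
qed

lemma mean_mult:
  assumes "bounded_fun f"
  shows "mean (\<lambda>y. c * f y) = c * mean f"
proof -
  have "\<mu> (\<lambda>y\<in>carrier G. c * restrict f (carrier G) y) = c * mean f"
    using state assms restrict_in_linfinity unfolding state_on_linfinity_def mean_def by blast
  also have "(\<lambda>y\<in>carrier G. c * restrict f (carrier G) y) = (\<lambda>y\<in>carrier G. c * f y)"
    by (rule restrict_ext) simp
  finally show ?thesis
    unfolding mean_def .
qed

lemma mean_nonneg:
  assumes "bounded_fun f" "\<And>y. y \<in> carrier G \<Longrightarrow> 0 \<le> f y"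
  shows "0 \<le> mean f"
proof -
  have "\<forall>y\<in>carrier G. 0 \<le> restrict f (carrier G) y"
    using assms(2) by simp
  moreover have "\<forall>f\<in>linfinity G. (\<forall>x\<in>carrier G. 0 \<le> f x) \<longrightarrow> 0 \<le> \<mu> f"
    using state unfolding state_on_linfinity_def by (elim conjE)
  ultimately show ?thesis
    using restrict_in_linfinity[OF assms(1)] unfolding mean_def by blast
qed

lemma mean_const [simp]: "mean (\<lambda>y. c) = c"
proof -
  have "mean (\<lambda>y. c * 1) = c * mean (\<lambda>y. 1)"
    by (rule mean_mult) simp
  also have "mean (\<lambda>y. 1) = 1"
    using state unfolding state_on_linfinity_def mean_def by blast
  finally show ?thesis by simp
qed

lemma mean_sum:
  "(\<And>i. i \<in> I \<Longrightarrow> bounded_fun (f i)) \<Longrightarrow> mean (\<lambda>y. \<Sum>i\<in>I. f i y) = (\<Sum>i\<in>I. mean (f i))"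
proof (induction I rule: infinite_finite_induct)
  case (insert i I)
  then show ?case
    using mean_add[of "f i" "\<lambda>y. \<Sum>i\<in>I. f i y"] by simp
qed auto

text \<open>Adding a constant bound \<open>B\<close> makes the function nonnegative, so the mean of
  the sum is nonnegative, hence real; the mean of the constant is real too.\<close>

lemma Im_mean_of_real:
  assumes "bounded_fun (\<lambda>y. of_real (u y))"
  shows "Im (mean (\<lambda>y. of_real (u y))) = 0"
proof -
  obtain B where B: "\<forall>y\<in>carrier G. \<bar>u y\<bar> \<le> B"
    using assms by (auto simp: bounded_fun_iff)
  have "0 \<le> mean (\<lambda>y. of_real (u y) + of_real B)"
  proof (rule mean_nonneg)
    show "bounded_fun (\<lambda>y. of_real (u y) + of_real B)"
      using assms by (intro bounded_fun_add bounded_fun_const)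
    fix y assume "y \<in> carrier G"
    then have "\<bar>u y\<bar> \<le> B"
      using B by blast
    then show "0 \<le> of_real (u y) + complex_of_real B"
      by (simp add: less_eq_complex_def)
  qed
  then show ?thesis
    using mean_add[OF assms, of "\<lambda>y. of_real B"] by (simp add: less_eq_complex_def)
qed

text \<open>Both \<open>f + cnj f\<close> and \<open>\<i> * (f - cnj f)\<close> are real-valued, so
  their means have imaginary part zero. By linearity these two equations determine the imaginary and
  the real part of the mean of \<open>cnj f\<close>.\<close>

lemma mean_cnj:
  assumes f: "bounded_fun f"
  shows "mean (\<lambda>y. cnj (f y)) = cnj (mean f)"
proof -
  have "mean (\<lambda>y. f y + cnj (f y)) = mean f + mean (\<lambda>y. cnj (f y))"
    using f by (simp only: mean_add bounded_fun_cnj)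
  moreover have "mean (\<lambda>y. \<i> * (f y + - 1 * cnj (f y))) = \<i> * (mean f + - 1 * mean (\<lambda>y. cnj (f y)))"
    using f by (simp only: mean_mult mean_add bounded_fun_add bounded_fun_mult bounded_fun_cnj)
  moreover have "Im (mean (\<lambda>y. f y + cnj (f y))) = 0"
    using Im_mean_of_real[of "\<lambda>y. 2 * Re (f y)"] bounded_fun_mult[OF bounded_fun_Re[OF f], of 2]
    by (simp add: complex_add_cnj)
  moreover have "Im (mean (\<lambda>y. \<i> * (f y + - 1 * cnj (f y)))) = 0"
  proof -
    have eq: "\<i> * (f y + - 1 * cnj (f y)) = of_real (- 2 * Im (f y))" for y
      by (simp add: complex_eq_iff)
    have "bounded_fun (\<lambda>y. \<i> * (f y + - 1 * cnj (f y)))"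
      using f by (intro bounded_fun_mult bounded_fun_add bounded_fun_cnj)
    then show ?thesis
      unfolding eq by (rule Im_mean_of_real)
  qed
  ultimately show ?thesis
    by (simp add: complex_eq_iff)
qed

lemma mean_Re:
  assumes f: "bounded_fun f"
  shows "mean (\<lambda>y. of_real (Re (f y))) = of_real (Re (mean f))"
proof -
  have "of_real (Re (f y)) = (1/2) * (f y + cnj (f y))" for y
    by (simp add: complex_add_cnj)
  then have "mean (\<lambda>y. of_real (Re (f y))) = (1/2) * (mean f + cnj (mean f))"
    using f by (simp only: mean_mult mean_add mean_cnj bounded_fun_add bounded_fun_cnj)
  then show ?thesis
    by (simp add: complex_add_cnj)
qed

text \<open>A unimodular factor \<open>c\<close> rotates the mean onto its modulus. The claim then
  follows from positivity applied to \<open>B - Re (c * f y)\<close>.\<close>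

lemma cmod_mean_le:
  assumes B: "\<And>y. y \<in> carrier G \<Longrightarrow> cmod (f y) \<le> B"
  shows "cmod (mean f) \<le> B"
proof -
  have f: "bounded_fun f"
    using B by (rule bounded_funI)
  obtain c where c: "cmod c = 1" "c * mean f = of_real (cmod (mean f))"
  proof (cases "mean f = 0")
    case True
    then show ?thesis using that[of 1] by simp
  next
    case False
    then show ?thesis
      using that[of "of_real (cmod (mean f)) / mean f"] by (simp add: norm_divide)
  qed
  have "mean (\<lambda>y. of_real B + (- 1) * of_real (Re (c * f y))) = of_real B - of_real (Re (c * mean f))"
    using f by (simp only: mean_add mean_mult mean_Re bounded_fun_mult bounded_fun_Re
        bounded_fun_const mean_const) simp
  moreover have "0 \<le> mean (\<lambda>y. of_real B + (- 1) * of_real (Re (c * f y)))"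
  proof (rule mean_nonneg)
    show "bounded_fun (\<lambda>y. of_real B + (- 1) * of_real (Re (c * f y)))"
      using f by (intro bounded_fun_add bounded_fun_mult bounded_fun_Re bounded_fun_const)
    fix y assume "y \<in> carrier G"
    then have "Re (c * f y) \<le> B"
      using B[of y] complex_Re_le_cmod[of "c * f y"] c(1) by (simp add: norm_mult)
    then show "0 \<le> of_real B + (- 1) * complex_of_real (Re (c * f y))"
      by (simp add: less_eq_complex_def)
  qed
  ultimately show ?thesis
    using c(2) by (simp add: less_eq_complex_def)
qed

end

section \<open>Weak means of bounded families of vectors\<close>

locale hilbert_space_mean = hilbert_space H + linfinity_state G \<mu>
  for H :: "'h cinner_space" (structure) and G :: "('g, 'm) monoid_scheme" and \<mu>
begin

definition bounded_family :: "('g \<Rightarrow> 'h) \<Rightarrow> bool"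
  where "bounded_family b \<longleftrightarrow>
    b \<in> carrier G \<rightarrow> carrier H \<and> (\<exists>B. \<forall>y\<in>carrier G. hnorm H (b y) \<le> B)"

text \<open>A weak (Pettis) integral of \<open>b\<close> against the state. The family stands in the
  second slot so that the functional in \<open>x\<close> is linear and Riesz representation applies
  as it stands.\<close>

definition weak_mean :: "('g \<Rightarrow> 'h) \<Rightarrow> 'h"
  where "weak_mean b =
    (THE z. z \<in> carrier H \<and> (\<forall>x\<in>carrier H. mean (\<lambda>y. cinner H x (b y)) = cinner H x z))"

lemma bounded_fun_cinner:
  assumes b: "bounded_family b" and x: "x \<in> carrier H"
  shows "bounded_fun (\<lambda>y. cinner H x (b y))"
proof -
  obtain B where B: "\<And>y. y \<in> carrier G \<Longrightarrow> hnorm H (b y) \<le> B"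
    using b by (auto simp: bounded_family_def)
  have "cmod (cinner H x (b y)) \<le> hnorm H x * B" if "y \<in> carrier G" for y
  proof -
    have "b y \<in> carrier H"
      using b that by (auto simp: bounded_family_def)
    then show ?thesis
      using cinner_Cauchy_Schwarz[OF x, of "b y"] mult_left_mono[OF B[OF that], of "hnorm H x"] x
      by simp
  qed
  then show ?thesis
    by (rule bounded_funI)
qed

lemma weak_mean_eqI:
  assumes "z \<in> carrier H" "\<And>x. x \<in> carrier H \<Longrightarrow> mean (\<lambda>y. cinner H x (b y)) = cinner H x z"
  shows "weak_mean b = z"
  unfolding weak_mean_def
proof (rule the_equality)
  fix z' assume "z' \<in> carrier H \<and> (\<forall>x\<in>carrier H. mean (\<lambda>y. cinner H x (b y)) = cinner H x z')"
  then show "z' = z"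
    using assms by (intro cinner_eqI) auto
qed (use assms in auto)

text \<open>A norm bound for the family bounds the functional sending \<open>x\<close> to the mean
  of \<open>cinner H x (b y)\<close>, so Riesz representation supplies the weak mean.\<close>

lemma
  assumes b: "bounded_family b"
  shows weak_mean_closed [simp, intro]: "weak_mean b \<in> carrier H"
    and mean_cinner_right:
      "x \<in> carrier H \<Longrightarrow> mean (\<lambda>y. cinner H x (b y)) = cinner H x (weak_mean b)"
proof -
  obtain B where B: "\<And>y. y \<in> carrier G \<Longrightarrow> hnorm H (b y) \<le> B"
    using b by (auto simp: bounded_family_def)
  have b_in: "b y \<in> carrier H" if "y \<in> carrier G" for y
    using b that by (auto simp: bounded_family_def)
  have "mean (\<lambda>y. cinner H (x \<oplus> x') (b y)) = mean (\<lambda>y. cinner H x (b y)) + mean (\<lambda>y. cinner H x' (b y))"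
    if "x \<in> carrier H" "x' \<in> carrier H" for x x'
  proof -
    have "mean (\<lambda>y. cinner H (x \<oplus> x') (b y)) = mean (\<lambda>y. cinner H x (b y) + cinner H x' (b y))"
      using that b_in by (intro mean_cong) (simp add: cinner_add_left)
    then show ?thesis
      using that b by (simp add: mean_add bounded_fun_cinner)
  qed
  moreover have "mean (\<lambda>y. cinner H (a \<odot> x) (b y)) = a * mean (\<lambda>y. cinner H x (b y))"
    if "x \<in> carrier H" for a x
  proof -
    have "mean (\<lambda>y. cinner H (a \<odot> x) (b y)) = mean (\<lambda>y. a * cinner H x (b y))"
      using that b_in by (intro mean_cong) (simp add: cinner_smult_left)
    then show ?thesis
      using that b by (simp add: mean_mult bounded_fun_cinner)
  qed
  moreover have "cmod (mean (\<lambda>y. cinner H x (b y))) \<le> B * hnorm H x" if "x \<in> carrier H" for x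
  proof (rule cmod_mean_le)
    fix y assume "y \<in> carrier G"
    then show "cmod (cinner H x (b y)) \<le> B * hnorm H x"
      using cinner_Cauchy_Schwarz[OF that b_in, of y] mult_left_mono[OF B, of y "hnorm H x"] that
      by (simp add: mult.commute)
  qed
  ultimately have "\<exists>z\<in>carrier H. \<forall>x\<in>carrier H. mean (\<lambda>y. cinner H x (b y)) = cinner H x z"
  proof (rule Riesz_representation)
    fix z assume "z \<in> carrier H" "\<And>x. x \<in> carrier H \<Longrightarrow> mean (\<lambda>y. cinner H x (b y)) = cinner H x z"
    then show ?thesis by auto
  qed
  then obtain z where z: "z \<in> carrier H"
    "\<And>x. x \<in> carrier H \<Longrightarrow> mean (\<lambda>y. cinner H x (b y)) = cinner H x z"
    by blast
  then have "weak_mean b = z"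
    by (rule weak_mean_eqI)
  with z show "weak_mean b \<in> carrier H"
    and "x \<in> carrier H \<Longrightarrow> mean (\<lambda>y. cinner H x (b y)) = cinner H x (weak_mean b)"
    by auto
qed

lemma bounded_fun_cinner_left:
  assumes b: "bounded_family b" and x: "x \<in> carrier H"
  shows "bounded_fun (\<lambda>y. cinner H (b y) x)"
proof -
  have "(\<lambda>y. cinner H (b y) x) ` carrier G = (\<lambda>y. cnj (cinner H x (b y))) ` carrier G"
    using b x by (intro image_cong refl cinner_commute) (auto simp: bounded_family_def)
  then show ?thesis
    using bounded_fun_cnj[OF bounded_fun_cinner[OF b x]] by (simp add: bounded_fun_def)
qed

lemma mean_cinner_left:
  assumes b: "bounded_family b" and x: "x \<in> carrier H"
  shows "mean (\<lambda>y. cinner H (b y) x) = cinner H (weak_mean b) x"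
proof -
  have "mean (\<lambda>y. cinner H (b y) x) = mean (\<lambda>y. cnj (cinner H x (b y)))"
    using b x by (intro mean_cong cinner_commute) (auto simp: bounded_family_def)
  also have "\<dots> = cnj (cinner H x (weak_mean b))"
    using b x by (simp add: mean_cnj mean_cinner_right bounded_fun_cinner)
  also have "\<dots> = cinner H (weak_mean b) x"
    using cinner_commute[of "weak_mean b" x] b x by simp
  finally show ?thesis .
qed

text \<open>Pairing the weak mean with itself bounds its squared norm by \<open>B\<close> times its
  norm.\<close>

lemma hnorm_weak_mean_le:
  assumes b: "bounded_family b" and B: "\<And>y. y \<in> carrier G \<Longrightarrow> hnorm H (b y) \<le> B" and "0 \<le> B"
  shows "hnorm H (weak_mean b) \<le> B"
proof -
  define z where "z = weak_mean b"
  have z: "z \<in> carrier H"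
    using b by (simp add: z_def)
  have "cmod (cinner H z z) \<le> hnorm H z * B"
    unfolding z_def mean_cinner_right[OF b z[unfolded z_def], symmetric]
  proof (rule cmod_mean_le)
    fix y assume y: "y \<in> carrier G"
    then have "b y \<in> carrier H"
      using b by (auto simp: bounded_family_def)
    from cinner_Cauchy_Schwarz[OF z this] show "cmod (cinner H (weak_mean b) (b y)) \<le> hnorm H (weak_mean b) * B"
      using mult_left_mono[OF B[OF y] hnorm_nonneg[OF z]] by (simp add: z_def)
  qed
  then have "hnorm H z * hnorm H z \<le> hnorm H z * B"
    using z by (simp add: cinner_self power2_eq_square norm_mult)
  then show ?thesis
    using \<open>0 \<le> B\<close> hnorm_nonneg[OF z] unfolding z_def[symmetric]
    by (cases "hnorm H z = 0") (auto simp: mult_le_cancel_left)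
qed

text \<open>The squared norm of \<open>b y\<close> cancels in the difference, leaving a real-affine
  function of \<open>b y\<close>. Its mean is found by putting the weak mean in place of
  \<open>b y\<close>, where the first square vanishes and the second remains.\<close>

lemma mean_hnorm_diff:
  assumes b: "bounded_family b" and v: "v \<in> carrier H"
  defines "f \<equiv> \<lambda>y. (hnorm H (b y \<ominus> weak_mean b))\<^sup>2 - (hnorm H (b y \<ominus> v))\<^sup>2"
  shows "bounded_fun (\<lambda>y. of_real (f y))"
    and "mean (\<lambda>y. of_real (f y)) = of_real (- (hnorm H (weak_mean b \<ominus> v))\<^sup>2)"
proof -
  define z where "z = weak_mean b"
  have z [simp]: "z \<in> carrier H"
    using b by (simp add: z_def)
  define c where "c = complex_of_real ((hnorm H z)\<^sup>2 - (hnorm H v)\<^sup>2)"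
  have f: "of_real (f y) = of_real (Re (2 * cinner H (b y) (v \<ominus> z))) + c" if "y \<in> carrier G" for y
  proof -
    have "b y \<in> carrier H"
      using b that by (auto simp: bounded_family_def)
    then show ?thesis
      using v by (simp add: f_def c_def hnorm_minus_power2 cinner_minus_right flip: z_def)
  qed
  have bdd: "bounded_fun (\<lambda>y. 2 * cinner H (b y) (v \<ominus> z))"
    using b v by (intro bounded_fun_mult bounded_fun_cinner_left) auto
  have "bounded_fun (\<lambda>y. of_real (Re (2 * cinner H (b y) (v \<ominus> z))) + c)"
    using bdd by (intro bounded_fun_add bounded_fun_Re bounded_fun_const)
  moreover have "(\<lambda>y. of_real (f y)) ` carrier G = (\<lambda>y. of_real (Re (2 * cinner H (b y) (v \<ominus> z))) + c) ` carrier G"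
    using f by (intro image_cong refl)
  ultimately show "bounded_fun (\<lambda>y. of_real (f y))"
    by (simp only: bounded_fun_def)
  have "mean (\<lambda>y. of_real (f y)) = mean (\<lambda>y. of_real (Re (2 * cinner H (b y) (v \<ominus> z))) + c)"
    using f by (rule mean_cong)
  also have "\<dots> = of_real (Re (mean (\<lambda>y. 2 * cinner H (b y) (v \<ominus> z)))) + c"
    using bdd by (simp only: mean_add bounded_fun_Re bounded_fun_const mean_const mean_Re)
  also have "mean (\<lambda>y. 2 * cinner H (b y) (v \<ominus> z)) = 2 * cinner H z (v \<ominus> z)"
    using b v by (simp add: mean_mult bounded_fun_cinner_left mean_cinner_left flip: z_def)
  also have "of_real (Re (2 * cinner H z (v \<ominus> z))) + c = of_real (- (hnorm H (z \<ominus> v))\<^sup>2)"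
    using v by (simp add: c_def hnorm_minus_power2 cinner_minus_right cinner_self)
  finally show "mean (\<lambda>y. of_real (f y)) = of_real (- (hnorm H (weak_mean b \<ominus> v))\<^sup>2)"
    by (simp add: z_def)
qed

end

section \<open>Amenability gives the positive definite approximant\<close>

context hilbert_space_mean
begin

lemma positive_definite_approximant:
  assumes G: "group G"
    and inv_mean: "\<forall>s\<in>carrier G. \<forall>f. bounded_fun f \<longrightarrow>
      mean (\<lambda>y. f (inv\<^bsub>G\<^esub> s \<otimes>\<^bsub>G\<^esub> y)) = mean f"
    and \<phi>: "\<phi> \<in> carrier G \<rightarrow> bounded_operators H" and ub: "uniformly_bounded G H \<phi>"
  defines "\<psi> \<equiv> \<lambda>x. \<lambda>\<xi>\<in>carrier H.
    weak_mean (\<lambda>y. \<phi> (x \<otimes>\<^bsub>G\<^esub> y) (adjoint_op H (\<phi> y) \<xi>))"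
  shows "\<psi> \<in> carrier G \<rightarrow> bounded_operators H"
    and "positive_definite G H \<psi>"
    and "\<And>F n \<xi> \<zeta>. \<lbrakk>F \<subseteq> carrier G; finite F;
        \<forall>i\<in>{1..n::nat}. \<xi> i \<in> F \<rightarrow> carrier H \<and> \<zeta> i \<in> F \<rightarrow> carrier H\<rbrakk> \<Longrightarrow>
      \<exists>y\<in>carrier G.
        (\<Sum>i=1..n. \<Sum>x\<in>F. (hnorm H
           (\<phi> (x \<otimes>\<^bsub>G\<^esub> y) (adjoint_op H (\<phi> y) (\<xi> i x)) \<ominus> \<psi> x (\<xi> i x)))\<^sup>2)
        \<le> (\<Sum>i=1..n. \<Sum>x\<in>F. (hnorm H
           (\<phi> (x \<otimes>\<^bsub>G\<^esub> y) (adjoint_op H (\<phi> y) (\<xi> i x)) \<ominus> \<zeta> i x))\<^sup>2)"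
proof -
  interpret G: group G by (rule G)
  define a where "a x \<xi> = (\<lambda>y. \<phi> (x \<otimes>\<^bsub>G\<^esub> y) (adjoint_op H (\<phi> y) \<xi>))" for x \<xi>
  have \<phi>_op [simp]: "\<phi> y \<in> bounded_operators H" if "y \<in> carrier G" for y
    using \<phi> that by blast
  obtain K' where K': "\<And>y. y \<in> carrier G \<Longrightarrow> operator_norm H (\<phi> y) \<le> K'"
    using ub unfolding uniformly_bounded_def bdd_above_def by blast
  define K where "K = max K' 0"
  have K_ge: "K \<ge> 0"
    by (simp add: K_def)
  have K: "hnorm H (\<phi> y \<xi>) \<le> K * hnorm H \<xi>" if "y \<in> carrier G" "\<xi> \<in> carrier H" for y \<xi>
  proof -
    have "hnorm H (\<phi> y \<xi>) \<le> operator_norm H (\<phi> y) * hnorm H \<xi>"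
      using that by (intro hnorm_le_operator_norm) auto
    also have "\<dots> \<le> K * hnorm H \<xi>"
      using K'[OF that(1)] that by (intro mult_right_mono) (auto simp: K_def)
    finally show ?thesis .
  qed
  have a_in [simp]: "a x \<xi> y \<in> carrier H"
    if "x \<in> carrier G" "y \<in> carrier G" "\<xi> \<in> carrier H" for x y \<xi>
    using that by (simp add: a_def bounded_operator_closed adjoint_op_closed)
  have a_bound: "hnorm H (a x \<xi> y) \<le> K * (K * hnorm H \<xi>)"
    if "x \<in> carrier G" "y \<in> carrier G" "\<xi> \<in> carrier H" for x y \<xi>
  proof -
    have "hnorm H (a x \<xi> y) \<le> K * hnorm H (adjoint_op H (\<phi> y) \<xi>)"
      using that unfolding a_def by (intro K) auto
    also have "\<dots> \<le> K * (K * hnorm H \<xi>)"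
      using that K K_ge by (intro mult_left_mono hnorm_adjoint_op_le) auto
    finally show ?thesis .
  qed
  have a_fam [simp]: "bounded_family (a x \<xi>)" if "x \<in> carrier G" "\<xi> \<in> carrier H" for x \<xi>
    using that a_bound unfolding bounded_family_def by auto
  have \<psi>: "\<psi> x \<xi> = weak_mean (a x \<xi>)" if "\<xi> \<in> carrier H" for x \<xi>
    using that by (simp add: \<psi>_def a_def)
  have \<psi>_in [simp]: "\<psi> x \<xi> \<in> carrier H" if "x \<in> carrier G" "\<xi> \<in> carrier H" for x \<xi>
    using that by (simp add: \<psi>)
  show "\<psi> \<in> carrier G \<rightarrow> bounded_operators H"
  proof
    fix x assume x: "x \<in> carrier G"
    have "\<psi> x (\<xi> \<oplus> \<eta>) = \<psi> x \<xi> \<oplus> \<psi> x \<eta>" if [simp]: "\<xi> \<in> carrier H" "\<eta> \<in> carrier H" for \<xi> \<eta>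
    proof -
      have "weak_mean (a x (\<xi> \<oplus> \<eta>)) = weak_mean (a x \<xi>) \<oplus> weak_mean (a x \<eta>)"
      proof (rule weak_mean_eqI)
        fix v assume v: "v \<in> carrier H"
        have "a x (\<xi> \<oplus> \<eta>) y = a x \<xi> y \<oplus> a x \<eta> y" if "y \<in> carrier G" for y
          using that x by (simp add: a_def adjoint_op_add bounded_operator_add adjoint_op_closed)
        then have "mean (\<lambda>y. cinner H v (a x (\<xi> \<oplus> \<eta>) y)) = mean (\<lambda>y. cinner H v (a x \<xi> y) + cinner H v (a x \<eta> y))"
          using x v by (intro mean_cong) (simp add: cinner_add_right)
        then show "mean (\<lambda>y. cinner H v (a x (\<xi> \<oplus> \<eta>) y)) = cinner H v (weak_mean (a x \<xi>) \<oplus> weak_mean (a x \<eta>))"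
          using x v by (simp add: mean_add bounded_fun_cinner mean_cinner_right cinner_add_right)
      qed (use x in simp)
      then show ?thesis by (simp add: \<psi>)
    qed
    moreover have "\<psi> x (c \<odot> \<xi>) = c \<odot> \<psi> x \<xi>" if [simp]: "\<xi> \<in> carrier H" for c \<xi>
    proof -
      have "weak_mean (a x (c \<odot> \<xi>)) = c \<odot> weak_mean (a x \<xi>)"
      proof (rule weak_mean_eqI)
        fix v assume v: "v \<in> carrier H"
        have "a x (c \<odot> \<xi>) y = c \<odot> a x \<xi> y" if "y \<in> carrier G" for y
          using that x by (simp add: a_def adjoint_op_smult bounded_operator_smult adjoint_op_closed)
        then have "mean (\<lambda>y. cinner H v (a x (c \<odot> \<xi>) y)) = mean (\<lambda>y. cnj c * cinner H v (a x \<xi> y))"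
          using x v by (intro mean_cong) (simp add: cinner_smult_right)
        then show "mean (\<lambda>y. cinner H v (a x (c \<odot> \<xi>) y)) = cinner H v (c \<odot> weak_mean (a x \<xi>))"
          using x v by (simp add: mean_mult bounded_fun_cinner mean_cinner_right cinner_smult_right)
      qed (use x in simp)
      then show ?thesis by (simp add: \<psi>)
    qed
    moreover have "hnorm H (\<psi> x \<xi>) \<le> (K * K) * hnorm H \<xi>" if "\<xi> \<in> carrier H" for \<xi>
      using hnorm_weak_mean_le[of "a x \<xi>" "K * (K * hnorm H \<xi>)"] a_bound[OF x _ that] K_ge x that
      by (simp add: \<psi> mult.assoc)
    moreover have "\<psi> x \<in> carrier H \<rightarrow>\<^sub>E carrier H"
      using x \<psi>_in by (auto simp: \<psi>_def)
    ultimately show "\<psi> x \<in> bounded_operators H"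
      unfolding bounded_operators_def by blast
  qed
  show "positive_definite G H \<psi>"
    unfolding positive_definite_def
  proof (intro allI impI ballI)
    fix m :: nat and x \<xi>
    assume x: "x \<in> {1..m} \<rightarrow> carrier G" and \<xi>: "\<xi> \<in> {1..m} \<rightarrow> carrier H"
    \<comment> \<open>Chosen so that, after translation, the entry with indices \<open>i\<close> and
      \<open>j\<close> becomes the mean of \<open>cinner H (c j y) (c i y)\<close>; for each fixed
      \<open>y\<close> the double sum is then the square of a norm.\<close>
    define c where "c i y = adjoint_op H (\<phi> (inv\<^bsub>G\<^esub> (x i) \<otimes>\<^bsub>G\<^esub> y)) (\<xi> i)" for i y
    have x_in: "x i \<in> carrier G" and \<xi>_in: "\<xi> i \<in> carrier H" if "i \<in> {1..m}" for i
      using x \<xi> that by blast+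
    have c_in: "c i y \<in> carrier H" if "i \<in> {1..m}" "y \<in> carrier G" for i y
      using that x_in \<xi>_in by (simp add: c_def adjoint_op_closed)
    have entry: "bounded_fun (\<lambda>y. cinner H (c j y) (c i y))"
      "cinner H (\<psi> (inv\<^bsub>G\<^esub> (x i) \<otimes>\<^bsub>G\<^esub> x j) (\<xi> j)) (\<xi> i) = mean (\<lambda>y. cinner H (c j y) (c i y))"
      if ij: "i \<in> {1..m}" "j \<in> {1..m}" for i j
    proof -
      note [simp] = x_in[OF ij(1)] x_in[OF ij(2)] \<xi>_in[OF ij(1)] \<xi>_in[OF ij(2)]
      define g where "g = inv\<^bsub>G\<^esub> (x i) \<otimes>\<^bsub>G\<^esub> x j"
      have [simp]: "g \<in> carrier G"
        by (simp add: g_def)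
      \<comment> \<open>Replacing \<open>y\<close> by the translate by the inverse of
        \<open>x j\<close> cancels \<open>x j\<close> in \<open>g\<close>; the outer operator then
        moves to the other side as its adjoint.\<close>
      have shift: "cinner H (a g (\<xi> j) (inv\<^bsub>G\<^esub> (x j) \<otimes>\<^bsub>G\<^esub> y)) (\<xi> i) = cinner H (c j y) (c i y)"
        if [simp]: "y \<in> carrier G" for y
      proof -
        have "g \<otimes>\<^bsub>G\<^esub> (inv\<^bsub>G\<^esub> (x j) \<otimes>\<^bsub>G\<^esub> y) = inv\<^bsub>G\<^esub> (x i) \<otimes>\<^bsub>G\<^esub> y"
          unfolding g_def by (simp add: G.m_assoc[symmetric] G.inv_solve_right)
             (simp add: G.m_assoc)
        then show ?thesis
          using c_in[OF ij(2) that] by (simp add: a_def c_def cinner_adjoint_op)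
      qed
      have bdd: "bounded_fun (\<lambda>y. cinner H (a g (\<xi> j) y) (\<xi> i))"
        by (intro bounded_fun_cinner_left) auto
      obtain B where B: "\<forall>y\<in>carrier G. cmod (cinner H (a g (\<xi> j) y) (\<xi> i)) \<le> B"
        using bdd by (auto simp: bounded_fun_iff)
      show "bounded_fun (\<lambda>y. cinner H (c j y) (c i y))"
      proof (rule bounded_funI)
        fix y assume "y \<in> carrier G"
        then show "cmod (cinner H (c j y) (c i y)) \<le> B"
          using B by (simp flip: shift)
      qed
      have "cinner H (\<psi> g (\<xi> j)) (\<xi> i) = mean (\<lambda>y. cinner H (a g (\<xi> j) y) (\<xi> i))"
        by (simp add: \<psi> mean_cinner_left)
      also have "\<dots> = mean (\<lambda>y. cinner H (a g (\<xi> j) (inv\<^bsub>G\<^esub> (x j) \<otimes>\<^bsub>G\<^esub> y)) (\<xi> i))"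
        using inv_mean[rule_format, OF _ bdd, of "x j"] by simp
      also have "\<dots> = mean (\<lambda>y. cinner H (c j y) (c i y))"
        using shift by (rule mean_cong)
      finally show "cinner H (\<psi> (inv\<^bsub>G\<^esub> (x i) \<otimes>\<^bsub>G\<^esub> x j) (\<xi> j)) (\<xi> i) = mean (\<lambda>y. cinner H (c j y) (c i y))"
        by (simp add: g_def)
    qed
    have "(\<Sum>i=1..m. \<Sum>j=1..m. cinner H (\<psi> (inv\<^bsub>G\<^esub> (x i) \<otimes>\<^bsub>G\<^esub> x j) (\<xi> j)) (\<xi> i))
        = (\<Sum>i=1..m. \<Sum>j=1..m. mean (\<lambda>y. cinner H (c j y) (c i y)))"
      using entry(2) by (intro sum.cong refl) auto
    also have "\<dots> = (\<Sum>i=1..m. mean (\<lambda>y. \<Sum>j=1..m. cinner H (c j y) (c i y)))"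
      using entry(1) by (intro sum.cong refl mean_sum[symmetric]) auto
    also have "\<dots> = mean (\<lambda>y. \<Sum>i=1..m. \<Sum>j=1..m. cinner H (c j y) (c i y))"
      using entry(1) by (intro mean_sum[symmetric] bounded_fun_sum) auto
    finally have "(\<Sum>i=1..m. \<Sum>j=1..m. cinner H (\<psi> (inv\<^bsub>G\<^esub> (x i) \<otimes>\<^bsub>G\<^esub> x j) (\<xi> j)) (\<xi> i))
        = mean (\<lambda>y. \<Sum>i=1..m. \<Sum>j=1..m. cinner H (c j y) (c i y))" .
    moreover have "0 \<le> mean (\<lambda>y. \<Sum>i=1..m. \<Sum>j=1..m. cinner H (c j y) (c i y))"
      using entry(1) c_in by (intro mean_nonneg bounded_fun_sum sum_cinner_pairs_nonneg) auto
    ultimately show "0 \<le> (\<Sum>i=1..m. \<Sum>j=1..m. cinner H (\<psi> (inv\<^bsub>G\<^esub> (x i) \<otimes>\<^bsub>G\<^esub> x j) (\<xi> j)) (\<xi> i))"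
      by simp
  qed
  fix F and n :: nat and \<xi> \<zeta>
  assume F: "F \<subseteq> carrier G" "finite F"
    and vec: "\<forall>i\<in>{1..n}. \<xi> i \<in> F \<rightarrow> carrier H \<and> \<zeta> i \<in> F \<rightarrow> carrier H"
  have vec': "\<xi> i x \<in> carrier H" "\<zeta> i x \<in> carrier H" "x \<in> carrier G" if "i \<in> {1..n}" "x \<in> F" for i x
    using vec that F by blast+
  \<comment> \<open>\<open>D\<close> is the contribution of one pair to the left side minus the
    right side of the required inequality; its mean is known exactly.\<close>
  define D where "D i x y = (hnorm H (a x (\<xi> i x) y \<ominus> weak_mean (a x (\<xi> i x))))\<^sup>2
      - (hnorm H (a x (\<xi> i x) y \<ominus> \<zeta> i x))\<^sup>2" for i x y
  have D_bdd: "bounded_fun (\<lambda>y. of_real (D i x y))"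
    and D_mean: "mean (\<lambda>y. of_real (D i x y)) = of_real (- (hnorm H (weak_mean (a x (\<xi> i x)) \<ominus> \<zeta> i x))\<^sup>2)"
    if "i \<in> {1..n}" "x \<in> F" for i x
    using mean_hnorm_diff[of "a x (\<xi> i x)" "\<zeta> i x"] vec'[OF that] unfolding D_def by simp_all
  have D_sum: "(\<Sum>i=1..n. \<Sum>x\<in>F. D i x y) =
      (\<Sum>i=1..n. \<Sum>x\<in>F. (hnorm H (a x (\<xi> i x) y \<ominus> \<psi> x (\<xi> i x)))\<^sup>2)
      - (\<Sum>i=1..n. \<Sum>x\<in>F. (hnorm H (a x (\<xi> i x) y \<ominus> \<zeta> i x))\<^sup>2)" for y
    unfolding sum_subtractf[symmetric] using vec' by (intro sum.cong refl) (simp add: D_def \<psi>)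
  have "\<exists>y\<in>carrier G. (\<Sum>i=1..n. \<Sum>x\<in>F. D i x y) \<le> 0"
  proof (rule ccontr)
    assume "\<not> ?thesis"
    then have pos: "(\<Sum>i=1..n. \<Sum>x\<in>F. D i x y) > 0" if "y \<in> carrier G" for y
      using that by force
    have "0 \<le> mean (\<lambda>y. \<Sum>i=1..n. \<Sum>x\<in>F. of_real (D i x y))"
    proof (rule mean_nonneg)
      show "bounded_fun (\<lambda>y. \<Sum>i=1..n. \<Sum>x\<in>F. of_real (D i x y))"
        using D_bdd by (intro bounded_fun_sum) auto
      show "0 \<le> (\<Sum>i=1..n. \<Sum>x\<in>F. complex_of_real (D i x y))" if "y \<in> carrier G" for y
        using pos[OF that] by (simp add: less_eq_complex_def)
    qed
    also have "mean (\<lambda>y. \<Sum>i=1..n. \<Sum>x\<in>F. of_real (D i x y)) =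
        (\<Sum>i=1..n. mean (\<lambda>y. \<Sum>x\<in>F. of_real (D i x y)))"
      using D_bdd by (intro mean_sum bounded_fun_sum) auto
    also have "\<dots> = (\<Sum>i=1..n. \<Sum>x\<in>F. mean (\<lambda>y. of_real (D i x y)))"
      using D_bdd by (intro sum.cong refl mean_sum) auto
    also have "\<dots> = of_real (- (\<Sum>i=1..n. \<Sum>x\<in>F. (hnorm H (weak_mean (a x (\<xi> i x)) \<ominus> \<zeta> i x))\<^sup>2))"
      using D_mean by (simp add: sum_negf)
    finally have "(\<Sum>i=1..n. \<Sum>x\<in>F. (hnorm H (weak_mean (a x (\<xi> i x)) \<ominus> \<zeta> i x))\<^sup>2) \<le> 0"
      by (simp add: less_eq_complex_def)
    \<comment> \<open>A strictly positive function is only known to have a nonnegative mean, so the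
      case of mean zero has to be excluded: it forces every \<open>\<zeta> i x\<close> to equal
      \<open>\<psi> x (\<xi> i x)\<close>, and then \<open>D\<close> vanishes at the identity,
      against \<open>pos\<close>.\<close>
    then have "(\<Sum>i=1..n. \<Sum>x\<in>F. (hnorm H (weak_mean (a x (\<xi> i x)) \<ominus> \<zeta> i x))\<^sup>2) = 0"
      by (intro antisym sum_nonneg) auto
    then have "\<forall>i\<in>{1..n}. \<forall>x\<in>F. (hnorm H (weak_mean (a x (\<xi> i x)) \<ominus> \<zeta> i x))\<^sup>2 = 0"
      using F by (simp add: sum_nonneg_eq_0_iff sum_nonneg)
    then have "weak_mean (a x (\<xi> i x)) = \<zeta> i x" if "i \<in> {1..n}" "x \<in> F" for i x
      using that vec'[OF that] hnorm_eq_0_iff[of "weak_mean (a x (\<xi> i x)) \<ominus> \<zeta> i x"] by simp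
    then have "(\<Sum>i=1..n. \<Sum>x\<in>F. D i x \<one>\<^bsub>G\<^esub>) = 0"
      by (simp add: D_def)
    then show False
      using pos[of "\<one>\<^bsub>G\<^esub>"] by simp
  qed
  then show "\<exists>y\<in>carrier G.
      (\<Sum>i=1..n. \<Sum>x\<in>F. (hnorm H
         (\<phi> (x \<otimes>\<^bsub>G\<^esub> y) (adjoint_op H (\<phi> y) (\<xi> i x)) \<ominus> \<psi> x (\<xi> i x)))\<^sup>2)
      \<le> (\<Sum>i=1..n. \<Sum>x\<in>F. (hnorm H
         (\<phi> (x \<otimes>\<^bsub>G\<^esub> y) (adjoint_op H (\<phi> y) (\<xi> i x)) \<ominus> \<zeta> i x))\<^sup>2)"
    unfolding D_sum a_def by simp
qed

end

section \<open>Amenability from the Dixmier condition\<close>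

text \<open>A pointwise minimal sublinear functional \<open>m \<le> p\<close> is linear, because
  \<open>f \<mapsto> inf\<^sub>t (m (f + t g) - t m g)\<close>, with \<open>t \<ge> 0\<close>, is again sublinear and at most \<open>m\<close>.\<close>

lemma linear_below_sublinear:
  fixes p :: "('a \<Rightarrow> real) \<Rightarrow> real"
  assumes V_add: "\<And>f g. f \<in> V \<Longrightarrow> g \<in> V \<Longrightarrow> (\<lambda>x. f x + g x) \<in> V"
    and V_scale: "\<And>c f. f \<in> V \<Longrightarrow> (\<lambda>x. c * f x) \<in> V"
    and p_add: "\<And>f g. f \<in> V \<Longrightarrow> g \<in> V \<Longrightarrow> p (\<lambda>x. f x + g x) \<le> p f + p g"
    and p_scale: "\<And>t f. f \<in> V \<Longrightarrow> 0 < t \<Longrightarrow> p (\<lambda>x. t * f x) \<le> t * p f"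
  obtains m where "\<And>f g. f \<in> V \<Longrightarrow> g \<in> V \<Longrightarrow> m (\<lambda>x. f x + g x) = m f + m g"
    and "\<And>c f. f \<in> V \<Longrightarrow> m (\<lambda>x. c * f x) = c * m f"
    and "\<And>f. f \<in> V \<Longrightarrow> m f \<le> p f"
proof -
  \<comment> \<open>The sublinear functionals below \<open>p\<close>. Fixing the value 0 off
    \<open>V\<close> makes pointwise comparison on the whole function type depend on
    \<open>V\<close> only.\<close>
  define S where "S = {q :: ('a \<Rightarrow> real) \<Rightarrow> real.
    (\<forall>f\<in>V. \<forall>g\<in>V. q (\<lambda>x. f x + g x) \<le> q f + q g) \<and>
    (\<forall>f\<in>V. \<forall>t>0. q (\<lambda>x. t * f x) \<le> t * q f) \<and>
    (\<forall>f\<in>V. q f \<le> p f) \<and> (\<forall>f. f \<notin> V \<longrightarrow> q f = 0)}"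
  have S_add: "q (\<lambda>x. f x + g x) \<le> q f + q g" if "q \<in> S" "f \<in> V" "g \<in> V" for q f g
    using that unfolding S_def by blast
  have S_scale: "q (\<lambda>x. t * f x) \<le> t * q f" if "q \<in> S" "f \<in> V" "t > 0" for q f t
    using that unfolding S_def by blast
  have S_le: "q f \<le> p f" if "q \<in> S" "f \<in> V" for q f
    using that unfolding S_def by blast
  have S_out: "q f = 0" if "q \<in> S" "f \<notin> V" for q f
    using that unfolding S_def by blast
  have S_zero: "0 \<le> q (\<lambda>x. 0)" if "q \<in> S" for q
  proof (cases "(\<lambda>x. 0) \<in> V")
    case True
    then show ?thesis using S_add[OF that True True] by simp
  qed (simp add: S_out that)
  have V_neg: "(\<lambda>x. - f x) \<in> V" if "f \<in> V" for f
    using V_scale[OF that, of "- 1"] by simp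
  \<comment> \<open>A lower bound at \<open>f\<close> common to all of \<open>S\<close>, so that the
    infimum along a chain is finite.\<close>
  have S_lower: "- p (\<lambda>x. - f x) \<le> q f" if "q \<in> S" "f \<in> V" for q f
    using S_zero[OF that(1)] S_add[OF that V_neg[OF that(2)]] S_le[OF that(1) V_neg[OF that(2)]]
    by simp
  \<comment> \<open>Zorn's lemma for the reversed pointwise order: upper bounds of chains are
    pointwise infima, and a maximal element is pointwise minimal.\<close>
  have "\<exists>m\<in>S. \<forall>q\<in>S. (\<forall>f. q f \<le> m f) \<longrightarrow> q = m"
  proof (rule predicate_Zorn)
    show "partial_order_on S (relation_of (\<lambda>m q. \<forall>f. q f \<le> m f) S)"
      by (rule partial_order_on_relation_ofI) (auto intro: order_trans intro!: ext antisym)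
  next
    fix C assume C: "C \<in> Chains (relation_of (\<lambda>m q. \<forall>f. q f \<le> m f) S)"
    then have CS: "C \<subseteq> S"
      by (auto simp: Chains_def relation_of_def)
    have chain: "(\<forall>f. q f \<le> r f) \<or> (\<forall>f. r f \<le> q f)" if "q \<in> C" "r \<in> C" for q r
      using C that by (auto simp: Chains_def relation_of_def)
    show "\<exists>u\<in>S. \<forall>q\<in>C. \<forall>f. u f \<le> q f"
    proof (cases "C = {}")
      case True
      have "(\<lambda>f. if f \<in> V then p f else 0) \<in> S"
        unfolding S_def using p_add p_scale V_add V_scale by simp
      with True show ?thesis by blast
    next
      case False
      define u where "u f = (if f \<in> V then INF q\<in>C. q f else 0)" for f
      have u_le: "u f \<le> q f" if "q \<in> C" for q f
      proof (cases "f \<in> V")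
        case True
        have "bdd_below ((\<lambda>q. q f) ` C)"
          using S_lower True CS by (intro bdd_belowI[of _ "- p (\<lambda>x. - f x)"]) auto
        from cINF_lower[OF this that] show ?thesis
          using True by (simp add: u_def)
      qed (use that CS S_out[of q f] in \<open>auto simp: u_def\<close>)
      have u_ge: "a \<le> u f" if "f \<in> V" "\<And>q. q \<in> C \<Longrightarrow> a \<le> q f" for a f
        using that False by (simp add: u_def cINF_greatest)
      have "u \<in> S"
        unfolding S_def
      proof (intro CollectI conjI ballI allI impI)
        fix f g assume f: "f \<in> V" and g: "g \<in> V"
        have "u (\<lambda>x. f x + g x) - q g \<le> u f" if q: "q \<in> C" for q
        proof (rule u_ge[OF f])
          fix r assume r: "r \<in> C"
          \<comment> \<open>The smaller of \<open>q\<close> and \<open>r\<close>, which exists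
            because they are comparable; it allows subadditivity to be used for a single
            functional.\<close>
          obtain s where s: "s \<in> C" "s f \<le> r f" "s g \<le> q g"
            using chain[OF q r] q r by (metis order_refl)
          then show "u (\<lambda>x. f x + g x) - q g \<le> r f"
            using u_le[OF s(1), of "\<lambda>x. f x + g x"] S_add[OF _ f g, of s] CS by auto
        qed
        then have "u (\<lambda>x. f x + g x) - u f \<le> u g"
          by (intro u_ge[OF g]) (simp add: algebra_simps)
        then show "u (\<lambda>x. f x + g x) \<le> u f + u g"
          by simp
      next
        fix f and t :: real assume f: "f \<in> V" and t: "t > 0"
        have "u (\<lambda>x. t * f x) / t \<le> u f"
        proof (rule u_ge[OF f])
          fix q assume q: "q \<in> C"
          then have "u (\<lambda>x. t * f x) \<le> t * q f"
            using u_le[OF q, of "\<lambda>x. t * f x"] S_scale[OF _ f t, of q] CS by auto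
          then show "u (\<lambda>x. t * f x) / t \<le> q f"
            using t by (simp add: pos_divide_le_eq mult.commute)
        qed
        then show "u (\<lambda>x. t * f x) \<le> t * u f"
          using t by (simp add: pos_divide_le_eq mult.commute)
      next
        fix f assume f: "f \<in> V"
        obtain q where "q \<in> C"
          using False by blast
        then show "u f \<le> p f"
          using u_le[of q f] S_le[OF _ f, of q] CS by auto
      qed (simp add: u_def)
      then show ?thesis
        using u_le by blast
    qed
  qed
  then obtain m where m: "m \<in> S" and minimal: "\<And>q. q \<in> S \<Longrightarrow> (\<And>f. q f \<le> m f) \<Longrightarrow> q = m"
    by blast
  \<comment> \<open>The converse of the homogeneity inequality built into \<open>S\<close>, from
    scaling back by \<open>1 / t\<close>; the case \<open>t = 0\<close> is included for the infimum
    below.\<close>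
  have m_ge: "t * m g \<le> m (\<lambda>x. t * g x)" if "g \<in> V" "t \<ge> 0" for g t
  proof (cases "t = 0")
    case True
    then show ?thesis using S_zero[OF m] by simp
  next
    case False
    then have "t > 0"
      using that by simp
    moreover have "m (\<lambda>x. (1 / t) * (t * g x)) \<le> (1 / t) * m (\<lambda>x. t * g x)"
      using m \<open>t > 0\<close> by (intro S_scale V_scale that) auto
    ultimately show ?thesis
      by (simp add: pos_le_divide_eq mult.commute)
  qed
  have superadd: "m f + m g \<le> m (\<lambda>x. f x + g x)" if f: "f \<in> V" and g: "g \<in> V" for f g
  proof -
    \<comment> \<open>Taking \<open>t = 0\<close> gives \<open>q \<le> m\<close>, so minimality
      yields \<open>q = m\<close> once \<open>q\<close> lies in \<open>S\<close>; taking
      \<open>t = 1\<close> then gives superadditivity.\<close>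
    define q where "q f = (if f \<in> V then INF t\<in>{0..}. m (\<lambda>x. f x + t * g x) - t * m g else 0)" for f
    have in_V: "(\<lambda>x. f x + t * g x) \<in> V" if "f \<in> V" for f t
      using that g by (intro V_add V_scale)
    have q_le: "q f \<le> m (\<lambda>x. f x + t * g x) - t * m g" if f: "f \<in> V" and "t \<ge> 0" for f t
    proof -
      have "- m (\<lambda>x. - f x) \<le> m (\<lambda>x. f x + t * g x) - t * m g" if "t \<ge> 0" for t
        using m_ge[OF g that] S_add[OF m in_V[OF f, of t] V_neg[OF f]] by (simp add: algebra_simps)
      then have "bdd_below ((\<lambda>t. m (\<lambda>x. f x + t * g x) - t * m g) ` {0..})"
        by (intro bdd_belowI[of _ "- m (\<lambda>x. - f x)"]) auto
      from cINF_lower[OF this, of t] show ?thesis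
        using that by (simp add: q_def)
    qed
    have q_ge: "a \<le> q f" if "f \<in> V" "\<And>t. t \<ge> 0 \<Longrightarrow> a \<le> m (\<lambda>x. f x + t * g x) - t * m g" for a f
      using that by (auto simp: q_def intro!: cINF_greatest)
    have q_le_m: "q f \<le> m f" for f
      using q_le[of f 0] S_out[OF m, of f] by (cases "f \<in> V") (auto simp: q_def)
    have "q \<in> S"
      unfolding S_def
    proof (intro CollectI conjI ballI allI impI)
      fix f f' assume f: "f \<in> V" and f': "f' \<in> V"
      have "q (\<lambda>x. f x + f' x) - (m (\<lambda>x. f' x + s * g x) - s * m g) \<le> q f" if s: "s \<ge> 0" for s
      proof (rule q_ge[OF f])
        fix t :: real assume t: "t \<ge> 0"
        \<comment> \<open>The parameters of the two infima add up; in the scaling step below,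
          \<open>t\<close> is replaced by \<open>c * t\<close>.\<close>
        have "q (\<lambda>x. f x + f' x) \<le> m (\<lambda>x. (f x + f' x) + (t + s) * g x) - (t + s) * m g"
          using V_add[OF f f'] s t by (intro q_le) auto
        also have "(\<lambda>x. (f x + f' x) + (t + s) * g x) = (\<lambda>x. (f x + t * g x) + (f' x + s * g x))"
          by (auto simp: algebra_simps)
        also have "m (\<lambda>x. (f x + t * g x) + (f' x + s * g x)) \<le> m (\<lambda>x. f x + t * g x) + m (\<lambda>x. f' x + s * g x)"
          using f f' by (intro S_add m in_V)
        finally show "q (\<lambda>x. f x + f' x) - (m (\<lambda>x. f' x + s * g x) - s * m g) \<le> m (\<lambda>x. f x + t * g x) - t * m g"
          by (simp add: algebra_simps)
      qed
      then have "q (\<lambda>x. f x + f' x) - q f \<le> q f'"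
        by (intro q_ge[OF f']) (simp add: algebra_simps)
      then show "q (\<lambda>x. f x + f' x) \<le> q f + q f'"
        by simp
    next
      fix f and c :: real assume f: "f \<in> V" and c: "c > 0"
      have "q (\<lambda>x. c * f x) / c \<le> q f"
      proof (rule q_ge[OF f])
        fix t :: real assume t: "t \<ge> 0"
        have "q (\<lambda>x. c * f x) \<le> m (\<lambda>x. c * f x + (c * t) * g x) - (c * t) * m g"
          using V_scale[OF f] c t by (intro q_le) auto
        also have "(\<lambda>x. c * f x + (c * t) * g x) = (\<lambda>x. c * (f x + t * g x))"
          by (auto simp: algebra_simps)
        also have "m (\<lambda>x. c * (f x + t * g x)) \<le> c * m (\<lambda>x. f x + t * g x)"
          using f c by (intro S_scale m in_V)
        finally show "q (\<lambda>x. c * f x) / c \<le> m (\<lambda>x. f x + t * g x) - t * m g"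
          unfolding pos_divide_le_eq[OF c] by (simp add: algebra_simps)
      qed
      then show "q (\<lambda>x. c * f x) \<le> c * q f"
        using c by (simp add: pos_divide_le_eq mult.commute)
    next
      fix f assume "f \<in> V"
      then show "q f \<le> p f"
        using q_le_m[of f] S_le[OF m] by (meson order_trans)
    qed (simp add: q_def)
    then have "q = m"
      using q_le_m by (rule minimal)
    then show ?thesis
      using q_le[OF f, of 1] by simp
  qed
  have m_add: "m (\<lambda>x. f x + g x) = m f + m g" if "f \<in> V" "g \<in> V" for f g
    using superadd[OF that] S_add[OF m that] by simp
  have m_pos: "m (\<lambda>x. t * f x) = t * m f" if "f \<in> V" "t > 0" for f t
    using S_scale[OF m that] m_ge[OF that(1), of t] that by simp
  have m_zero: "m (\<lambda>x. 0) = 0" if "f \<in> V" for f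
    using m_add[OF V_scale[OF that, of 0] V_scale[OF that, of 0]] by simp
  have m_neg: "m (\<lambda>x. - f x) = - m f" if "f \<in> V" for f
    using m_add[OF that V_neg[OF that]] m_zero[OF that] by simp
  have "m (\<lambda>x. c * f x) = c * m f" if f: "f \<in> V" for c f
  proof -
    consider "c > 0" | "c = 0" | "- c > 0"
      by linarith
    then show ?thesis
    proof cases
      case 3
      then show ?thesis
        using m_pos[OF V_neg[OF f] 3] m_neg[OF f] by simp
    qed (use f m_pos m_zero in auto)
  qed
  then show thesis
    using that m_add S_le[OF m] by blast
qed

text \<open>The linear span of the differences between a bounded function and its left translates:
  scalars are absorbed into \<open>u\<close>, and one generator is added at a time.\<close>

inductive_set coboundaries :: "('g, 'm) monoid_scheme \<Rightarrow> ('g \<Rightarrow> real) set"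
  for G :: "('g, 'm) monoid_scheme" where
  zero: "(\<lambda>y. 0) \<in> coboundaries G"
| step: "\<lbrakk>d \<in> coboundaries G; s \<in> carrier G; bounded (u ` carrier G)\<rbrakk> \<Longrightarrow>
    (\<lambda>y. d y + (u (s \<otimes>\<^bsub>G\<^esub> y) - u y)) \<in> coboundaries G"

lemma coboundaries_add:
  assumes "d \<in> coboundaries G" "e \<in> coboundaries G"
  shows "(\<lambda>y. d y + e y) \<in> coboundaries G"
  using assms(2)
proof (induction rule: coboundaries.induct)
  case (step e s u)
  show ?case
    using coboundaries.step[OF step.IH step.hyps(2,3)] by (simp add: add.assoc)
qed (use assms(1) in simp)

lemma coboundaries_scale:
  assumes "d \<in> coboundaries G"
  shows "(\<lambda>y. c * d y) \<in> coboundaries G"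
  using assms
proof (induction rule: coboundaries.induct)
  case (step d s u)
  have "bounded ((\<lambda>y. c * u y) ` carrier G)"
    using bounded_scaling[OF step.hyps(3), of c] by (simp add: image_image)
  from coboundaries.step[OF step.IH step.hyps(2) this] show ?case
    by (simp add: algebra_simps)
qed (simp add: coboundaries.zero)

lemma coboundaries_translate:
  assumes "s \<in> carrier G" "bounded (u ` carrier G)"
  shows "(\<lambda>y. u (s \<otimes>\<^bsub>G\<^esub> y) - u y) \<in> coboundaries G"
  using coboundaries.step[OF coboundaries.zero assms] by simp

text \<open>Exposes the finite number of functions \<open>u k\<close> involved; that number later
  fixes the dimension of the Hilbert space.\<close>

lemma coboundaries_eq_sum:
  fixes G :: "('g, 'm) monoid_scheme"
  assumes "d \<in> coboundaries G"
  shows "\<exists>(n::nat) s u. (\<forall>k<n. s k \<in> carrier G \<and> bounded ((u k :: 'g \<Rightarrow> real) ` carrier G)) \<and>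
    d = (\<lambda>y. \<Sum>k<n. u k (s k \<otimes>\<^bsub>G\<^esub> y) - u k y)"
  using assms
proof (induction rule: coboundaries.induct)
  case zero
  show ?case by (intro exI[of _ "0::nat"]) simp
next
  case (step d s' u')
  then obtain n :: nat and s u where IH: "\<forall>k<n. s k \<in> carrier G \<and> bounded ((u k :: 'g \<Rightarrow> real) ` carrier G)"
    "d = (\<lambda>y. \<Sum>k<n. u k (s k \<otimes>\<^bsub>G\<^esub> y) - u k y)"
    by blast
  show ?case
  proof (intro exI[of _ "Suc n"] exI[of _ "s(n := s')"] exI[of _ "u(n := u')"] conjI)
    show "\<forall>k<Suc n. (s(n := s')) k \<in> carrier G \<and> bounded ((u(n := u')) k ` carrier G)"
      using IH(1) step.hyps by (auto simp: less_Suc_eq)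
  qed (simp add: IH(2))
qed

lemma bounded_coboundary:
  assumes "group G" "d \<in> coboundaries G"
  shows "bounded (d ` carrier G)"
  using assms(2)
proof (induction rule: coboundaries.induct)
  case (step d s u)
  interpret G: group G by fact
  have "(\<lambda>y. u (s \<otimes>\<^bsub>G\<^esub> y)) ` carrier G \<subseteq> u ` carrier G"
    using step.hyps(2) by auto
  then have "bounded ((\<lambda>y. u (s \<otimes>\<^bsub>G\<^esub> y)) ` carrier G)"
    using step.hyps(3) bounded_subset by blast
  then show ?case
    using step.IH step.hyps(3) by (intro bounded_plus_comp bounded_minus_comp)
qed (simp add: image_constant_conv)

text \<open>The functional \<open>p f\<close> is the infimum over coboundaries \<open>d\<close> of
  the supremum of \<open>f + d\<close>. A linear \<open>m\<close> below \<open>p\<close> is positive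
  and normalised and kills coboundaries, hence is a translation-invariant real mean; it is then
  extended complex-linearly.\<close>

lemma amenable_if_Dixmier:
  fixes G :: "('g, 'm) monoid_scheme"
  assumes G: "group G"
    and Dixmier: "\<And>d \<epsilon>. d \<in> coboundaries G \<Longrightarrow> \<epsilon> > 0 \<Longrightarrow> \<exists>y\<in>carrier G. d y \<le> \<epsilon>"
  shows "amenable G"
proof -
  interpret G: group G by (rule G)
  define V where "V = {f :: 'g \<Rightarrow> real. bounded (f ` carrier G)}"
  define U where "U f = {c. \<exists>d\<in>coboundaries G. \<forall>y\<in>carrier G. f y + d y \<le> c}" for f
  define p where "p f = Inf (U f)" for f
  have V_add: "(\<lambda>y. f y + g y) \<in> V" if "f \<in> V" "g \<in> V" for f g
    using that by (simp add: V_def bounded_plus_comp)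
  have V_scale: "(\<lambda>y. c * f y) \<in> V" if "f \<in> V" for c f
    using that bounded_scaling[of "f ` carrier G" c] by (simp add: V_def image_image)
  have p_le: "p f \<le> c" if f: "f \<in> V" and d: "d \<in> coboundaries G" "\<And>y. y \<in> carrier G \<Longrightarrow> f y + d y \<le> c"
    for f d c
  proof -
    obtain M where M: "\<forall>y\<in>carrier G. \<bar>f y\<bar> \<le> M"
      using f by (auto simp: V_def bounded_iff)
    have "- M - 1 \<le> b" if "b \<in> U f" for b
    proof -
      obtain e where e: "e \<in> coboundaries G" "\<forall>y\<in>carrier G. f y + e y \<le> b"
        using \<open>b \<in> U f\<close> by (auto simp: U_def)
      \<comment> \<open>The hypothesis applied to the negative of \<open>e\<close> provides a point
        where \<open>e\<close> is at least -1; this keeps \<open>U f\<close> bounded below and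
        \<open>p f\<close> meaningful.\<close>
      obtain y where y: "y \<in> carrier G" "- 1 * e y \<le> 1"
        using Dixmier[OF coboundaries_scale[OF e(1), of "- 1"], of 1] by auto
      have "\<bar>f y\<bar> \<le> M" "f y + e y \<le> b"
        using M e(2) y(1) by auto
      then show ?thesis
        using y(2) by simp
    qed
    then have "bdd_below (U f)"
      by (rule bdd_belowI)
    moreover have "c \<in> U f"
      using d by (auto simp: U_def)
    ultimately show ?thesis
      unfolding p_def by (intro cInf_lower)
  qed
  have p_ge: "a \<le> p f"
    if f: "f \<in> V" and "\<And>d c. d \<in> coboundaries G \<Longrightarrow> (\<And>y. y \<in> carrier G \<Longrightarrow> f y + d y \<le> c) \<Longrightarrow> a \<le> c"
    for f a
  proof -
    obtain M where "\<forall>y\<in>carrier G. \<bar>f y\<bar> \<le> M"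
      using f by (auto simp: V_def bounded_iff)
    then have "M \<in> U f"
      unfolding U_def using coboundaries.zero[of G] by (intro CollectI bexI[of _ "\<lambda>y. 0"]) (auto dest: abs_le_D1)
    then show ?thesis
      unfolding p_def using that(2) by (intro cInf_greatest) (auto simp: U_def)
  qed
  have p_add: "p (\<lambda>y. f y + g y) \<le> p f + p g" if f: "f \<in> V" and g: "g \<in> V" for f g
  proof -
    have "p (\<lambda>y. f y + g y) - p f \<le> p g"
    proof (rule p_ge[OF g])
      fix d c assume d: "d \<in> coboundaries G" "\<And>y. y \<in> carrier G \<Longrightarrow> g y + d y \<le> c"
      have "p (\<lambda>y. f y + g y) - c \<le> p f"
      proof (rule p_ge[OF f])
        fix e b assume e: "e \<in> coboundaries G" "\<And>y. y \<in> carrier G \<Longrightarrow> f y + e y \<le> b"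
        have "p (\<lambda>y. f y + g y) \<le> b + c"
        proof (rule p_le[OF V_add[OF f g] coboundaries_add[OF e(1) d(1)]])
          fix y assume "y \<in> carrier G"
          then show "f y + g y + (e y + d y) \<le> b + c"
            using d(2)[of y] e(2)[of y] by simp
        qed
        then show "p (\<lambda>y. f y + g y) - c \<le> b" by simp
      qed
      then show "p (\<lambda>y. f y + g y) - p f \<le> c" by simp
    qed
    then show ?thesis by simp
  qed
  have p_scale: "p (\<lambda>y. t * f y) \<le> t * p f" if f: "f \<in> V" and t: "t > 0" for f t
  proof -
    have "p (\<lambda>y. t * f y) / t \<le> p f"
    proof (rule p_ge[OF f])
      fix d c assume d: "d \<in> coboundaries G" "\<And>y. y \<in> carrier G \<Longrightarrow> f y + d y \<le> c"
      have "p (\<lambda>y. t * f y) \<le> t * c"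
      proof (rule p_le[OF V_scale[OF f] coboundaries_scale[OF d(1), of t]])
        fix y assume "y \<in> carrier G"
        then show "t * f y + t * d y \<le> t * c"
          using d(2)[of y] t by (simp flip: distrib_left)
      qed
      then show "p (\<lambda>y. t * f y) / t \<le> c"
        using t by (simp add: pos_divide_le_eq mult.commute)
    qed
    then show ?thesis
      using t by (simp add: pos_divide_le_eq mult.commute)
  qed
  obtain m where m_add: "\<And>f g. f \<in> V \<Longrightarrow> g \<in> V \<Longrightarrow> m (\<lambda>y. f y + g y) = m f + m g"
    and m_scale: "\<And>c f. f \<in> V \<Longrightarrow> m (\<lambda>y. c * f y) = c * m f"
    and m_le: "\<And>f. f \<in> V \<Longrightarrow> m f \<le> p f"
    using linear_below_sublinear[of V p, OF V_add V_scale p_add p_scale] by blast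
  have m_le_const: "m f \<le> c" if "f \<in> V" "\<And>y. y \<in> carrier G \<Longrightarrow> f y \<le> c" for f c
    using m_le[OF that(1)] p_le[OF that(1) coboundaries.zero, of c] that(2) by fastforce
  \<comment> \<open>Correcting \<open>d\<close> by the coboundary \<open>- d\<close> gives the zero
    function, so \<open>p d \<le> 0\<close>. The same bound for \<open>- d\<close> turns this into
    \<open>m d = 0\<close>.\<close>
  have m_cob_le: "m d \<le> 0" if d: "d \<in> coboundaries G" for d
  proof -
    have "d \<in> V"
      using bounded_coboundary[OF G d] by (simp add: V_def)
    then show ?thesis
      using m_le[of d] p_le[OF _ coboundaries_scale[OF d, of "- 1"], of d 0] by simp
  qed
  have m_cob: "m d = 0" if d: "d \<in> coboundaries G" for d
  proof -
    have "d \<in> V"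
      using bounded_coboundary[OF G d] by (simp add: V_def)
    then have "m (\<lambda>y. - 1 * d y) = - 1 * m d"
      by (rule m_scale)
    then show ?thesis
      using m_cob_le[OF d] m_cob_le[OF coboundaries_scale[OF d, of "- 1"]] by simp
  qed
  have m_one: "m (\<lambda>y. if y \<in> carrier G then 1 else 0) = 1"
  proof -
    let ?e = "\<lambda>y. if y \<in> carrier G then 1 else 0 :: real"
    have e: "?e \<in> V"
      by (auto simp: V_def bounded_iff)
    have "m (\<lambda>y. - 1 * ?e y) \<le> - 1"
      using V_scale[OF e, of "- 1"] by (intro m_le_const) auto
    then show ?thesis
      using m_le_const[OF e, of 1] m_scale[OF e, of "- 1"] by simp
  qed
  \<comment> \<open>Real and imaginary parts are extended by 0, so that linear relations on the
    carrier become equalities of functions on the whole type.\<close>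
  define R where "R f = (\<lambda>y. if y \<in> carrier G then Re (f y) else 0)" for f :: "'g \<Rightarrow> complex"
  define I where "I f = (\<lambda>y. if y \<in> carrier G then Im (f y) else 0)" for f :: "'g \<Rightarrow> complex"
  define \<mu> where "\<mu> f = Complex (m (R f)) (m (I f))" for f
  have RV: "R f \<in> V" and IV: "I f \<in> V" if f: "f \<in> linfinity G" for f
  proof -
    obtain B where B: "\<forall>y\<in>carrier G. cmod (f y) \<le> B"
      using f by (auto simp: linfinity_def bounded_iff)
    have "\<forall>y\<in>carrier G. \<bar>R f y\<bar> \<le> B" "\<forall>y\<in>carrier G. \<bar>I f y\<bar> \<le> B"
      using B order_trans[OF abs_Re_le_cmod] order_trans[OF abs_Im_le_cmod] by (auto simp: R_def I_def)
    then show "R f \<in> V" "I f \<in> V"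
      by (auto simp: V_def bounded_iff)
  qed
  have "state_on_linfinity G \<mu>"
    unfolding state_on_linfinity_def
  proof (intro conjI ballI allI impI)
    fix f g assume fg: "f \<in> linfinity G" "g \<in> linfinity G"
    have "R (\<lambda>x\<in>carrier G. f x + g x) = (\<lambda>y. R f y + R g y)"
      and "I (\<lambda>x\<in>carrier G. f x + g x) = (\<lambda>y. I f y + I g y)"
      by (auto simp: R_def I_def)
    then show "\<mu> (\<lambda>x\<in>carrier G. f x + g x) = \<mu> f + \<mu> g"
      using fg by (simp add: \<mu>_def m_add RV IV complex_eq_iff)
  next
    fix a f assume f: "f \<in> linfinity G"
    have "R (\<lambda>x\<in>carrier G. a * f x) = (\<lambda>y. Re a * R f y + - Im a * I f y)"
      and "I (\<lambda>x\<in>carrier G. a * f x) = (\<lambda>y. Re a * I f y + Im a * R f y)"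
      by (auto simp: R_def I_def)
    then show "\<mu> (\<lambda>x\<in>carrier G. a * f x) = a * \<mu> f"
      using RV[OF f] IV[OF f] by (simp only: \<mu>_def m_add m_scale V_scale) (simp add: complex_eq_iff)
  next
    fix f assume f: "f \<in> linfinity G" "\<forall>x\<in>carrier G. 0 \<le> f x"
    have "m (\<lambda>y. - 1 * R f y) \<le> 0"
      using f V_scale[OF RV[OF f(1)], of "- 1"] by (intro m_le_const) (auto simp: R_def less_eq_complex_def)
    moreover have "I f = (\<lambda>y. 0 * R f y)"
      using f(2) by (auto simp: I_def less_eq_complex_def)
    then have "m (I f) = 0 * m (R f)"
      using m_scale[OF RV[OF f(1)], of 0] by simp
    ultimately show "0 \<le> \<mu> f"
      using m_scale[OF RV[OF f(1)], of "- 1"] by (simp add: \<mu>_def less_eq_complex_def)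
  next
    have "R (\<lambda>x\<in>carrier G. 1) = (\<lambda>y. if y \<in> carrier G then 1 else 0)"
      and "I (\<lambda>x\<in>carrier G. 1) = (\<lambda>y. 0 * (if y \<in> carrier G then 1 else 0))"
      by (auto simp: R_def I_def)
    moreover have "(\<lambda>y. if y \<in> carrier G then 1 else 0 :: real) \<in> V"
      by (auto simp: V_def bounded_iff)
    from m_scale[OF this, of 0] have "m (\<lambda>y. 0 * (if y \<in> carrier G then 1 else 0)) = 0"
      by simp
    ultimately show "\<mu> (\<lambda>x\<in>carrier G. 1) = 1"
      by (simp only: \<mu>_def m_one one_complex.code)
  qed
  moreover have "\<mu> (\<lambda>x\<in>carrier G. f (inv\<^bsub>G\<^esub> s \<otimes>\<^bsub>G\<^esub> x)) = \<mu> f"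
    if s: "s \<in> carrier G" and f: "f \<in> linfinity G" for s f
  proof -
    let ?g = "\<lambda>x\<in>carrier G. f (inv\<^bsub>G\<^esub> s \<otimes>\<^bsub>G\<^esub> x)"
    have inv: "m v = m u"
      if u: "u \<in> V" and v: "v \<in> V" "\<And>y. y \<in> carrier G \<Longrightarrow> v y = u (inv\<^bsub>G\<^esub> s \<otimes>\<^bsub>G\<^esub> y)" for u v
    proof -
      let ?d = "\<lambda>y. u (inv\<^bsub>G\<^esub> s \<otimes>\<^bsub>G\<^esub> y) - u y"
      have d: "?d \<in> coboundaries G"
        using s u by (intro coboundaries_translate) (auto simp: V_def)
      have dV: "?d \<in> V"
        using bounded_coboundary[OF G d] by (simp add: V_def)
      \<comment> \<open>\<open>v\<close> and \<open>u + ?d\<close> agree on the carrier but possibly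
        not elsewhere. Bounding both differences by 0 on the carrier shows that \<open>m\<close>
        does not distinguish them.\<close>
      have "m (\<lambda>y. (u y + ?d y) + - 1 * v y) \<le> 0" "m (\<lambda>y. v y + - 1 * (u y + ?d y)) \<le> 0"
        using u v dV by (intro m_le_const V_add V_scale; simp)+
      then show ?thesis
        using u v(1) dV m_cob[OF d] by (simp only: m_add m_scale V_add V_scale) simp
    qed
    have "?g ` carrier G \<subseteq> f ` carrier G"
      using s by auto
    then have g: "?g \<in> linfinity G"
      using f bounded_subset by (auto simp: linfinity_def)
    have "m (R ?g) = m (R f)"
      using s by (intro inv[OF RV[OF f] RV[OF g]]) (simp add: R_def)
    moreover have "m (I ?g) = m (I f)"
      using s by (intro inv[OF IV[OF f] IV[OF g]]) (simp add: I_def)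
    ultimately show ?thesis
      by (simp add: \<mu>_def)
  qed
  ultimately show ?thesis
    unfolding amenable_def by blast
qed

section \<open>Finite-dimensional Hilbert spaces on a given type\<close>

text \<open>Realises every finite dimension inside the single type of sequences, so that one
  injection into \<open>'h\<close> serves for all \<open>n\<close>.\<close>

definition finite_support_below :: "nat \<Rightarrow> (nat \<Rightarrow> complex) set"
  where "finite_support_below n = {v. \<forall>i\<ge>n. v i = 0}"

text \<open>The space \<open>\<complex>\<^sup>n\<close>, carried over to the type \<open>'h\<close> by an injection \<open>\<iota>\<close>.\<close>

definition coordinate_space :: "((nat \<Rightarrow> complex) \<Rightarrow> 'h) \<Rightarrow> nat \<Rightarrow> 'h cinner_space"
  where "coordinate_space \<iota> n =
    \<lparr>carrier = \<iota> ` finite_support_below n,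
     mult = (\<lambda>x y. \<iota> (\<lambda>i. 0)), one = \<iota> (\<lambda>i. 0), zero = \<iota> (\<lambda>i. 0),
     add = (\<lambda>x y. \<iota> (\<lambda>i. inv_into UNIV \<iota> x i + inv_into UNIV \<iota> y i)),
     smult = (\<lambda>a x. \<iota> (\<lambda>i. a * inv_into UNIV \<iota> x i)),
     cinner = (\<lambda>x y. \<Sum>i<n. inv_into UNIV \<iota> x i * cnj (inv_into UNIV \<iota> y i))\<rparr>"

lemma finite_support_below_closed [simp, intro]:
  "(\<lambda>i. 0) \<in> finite_support_below n"
  "v \<in> finite_support_below n \<Longrightarrow> w \<in> finite_support_below n \<Longrightarrow> (\<lambda>i. v i + w i) \<in> finite_support_below n"
  "v \<in> finite_support_below n \<Longrightarrow> w \<in> finite_support_below n \<Longrightarrow> (\<lambda>i. v i - w i) \<in> finite_support_below n"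
  "v \<in> finite_support_below n \<Longrightarrow> (\<lambda>i. a * v i) \<in> finite_support_below n"
  "v \<in> finite_support_below n \<Longrightarrow> (\<lambda>i. - v i) \<in> finite_support_below n"
  by (auto simp: finite_support_below_def)

section \<open>Hilbert space structure on the coordinate space\<close>

context
  fixes \<iota> :: "(nat \<Rightarrow> complex) \<Rightarrow> 'h" and n :: nat
  assumes inj: "inj \<iota>"
begin

private abbreviation "E \<equiv> coordinate_space \<iota> n"

lemma carrier_coordinate_space: "carrier E = \<iota> ` finite_support_below n"
  by (simp add: coordinate_space_def)

lemma zero_coordinate_space: "\<zero>\<^bsub>E\<^esub> = \<iota> (\<lambda>i. 0)"
  by (simp add: coordinate_space_def)

lemma add_coordinate_space: "\<iota> v \<oplus>\<^bsub>E\<^esub> \<iota> w = \<iota> (\<lambda>i. v i + w i)"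
  by (simp add: coordinate_space_def inj)

lemma smult_coordinate_space: "a \<odot>\<^bsub>E\<^esub> \<iota> v = \<iota> (\<lambda>i. a * v i)"
  by (simp add: coordinate_space_def inj)

lemma cinner_coordinate_space: "cinner E (\<iota> v) (\<iota> w) = (\<Sum>i<n. v i * cnj (w i))"
  by (simp add: coordinate_space_def inj)

lemmas coordinate_space_simps = zero_coordinate_space add_coordinate_space
  smult_coordinate_space cinner_coordinate_space

lemma complex_inner_space_coordinate_space: "complex_inner_space E"
proof -
  have "abelian_group E"
  proof (rule abelian_groupI)
    fix x assume "x \<in> carrier E"
    then obtain v where v: "v \<in> finite_support_below n" "x = \<iota> v"
      by (auto simp: carrier_coordinate_space)
    then show "\<exists>y\<in>carrier E. y \<oplus>\<^bsub>E\<^esub> x = \<zero>\<^bsub>E\<^esub>"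
      by (intro bexI[of _ "\<iota> (\<lambda>i. - v i)"])
        (simp_all add: coordinate_space_simps carrier_coordinate_space)
  qed (auto simp: carrier_coordinate_space coordinate_space_simps add_ac)
  then have "module (ring_of_type_algebra :: complex ring) E"
    by (intro moduleI)
      (auto simp: carrier_coordinate_space coordinate_space_simps algebra_simps
        cring_from_type_algebra)
  then show ?thesis
  proof (intro complex_inner_space.intro complex_inner_space_axioms.intro)
    fix x assume x: "x \<in> carrier E"
    then obtain v where v: "v \<in> finite_support_below n" "x = \<iota> v"
      by (auto simp: carrier_coordinate_space)
    then have xx: "cinner E x x = of_real (\<Sum>i<n. (cmod (v i))\<^sup>2)"
      by (simp only: cinner_coordinate_space of_real_sum complex_norm_square)
    then show "0 \<le> cinner E x x"
      by (simp only: less_eq_complex_def) (simp add: sum_nonneg)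
    assume "cinner E x x = 0"
    then have "\<forall>i<n. v i = 0"
      using xx by (simp only: of_real_eq_0_iff) (simp add: sum_nonneg_eq_0_iff)
    then have "v = (\<lambda>i. 0)"
      using v(1) by (auto simp: finite_support_below_def fun_eq_iff) (meson not_less)
    then show "x = \<zero>\<^bsub>E\<^esub>"
      by (simp add: v coordinate_space_simps)
  qed (auto simp: carrier_coordinate_space coordinate_space_simps algebra_simps
      sum.distrib sum_distrib_left cnj_sum)
qed

interpretation E: complex_inner_space E
  by (rule complex_inner_space_coordinate_space)

lemma hnorm_coordinate_space: "hnorm E (\<iota> v) = L2_set (\<lambda>i. cmod (v i)) {..<n}"
  by (simp add: hnorm_def L2_set_def coordinate_space_simps complex_norm_square[symmetric]
      del: of_real_power)

lemma hdist_coordinate_space: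
  assumes "v \<in> finite_support_below n" "w \<in> finite_support_below n"
  shows "hdist E (\<iota> v) (\<iota> w) = L2_set (\<lambda>i. cmod (v i - w i)) {..<n}"
proof -
  have [simp]: "\<iota> v \<in> carrier E" "\<iota> w \<in> carrier E" "\<iota> (\<lambda>i. v i - w i) \<in> carrier E"
    using assms by (auto simp: carrier_coordinate_space)
  have "\<iota> v \<ominus>\<^bsub>E\<^esub> \<iota> w = \<iota> (\<lambda>i. v i - w i)"
  proof (rule E.cinner_eqI)
    fix z assume z: "z \<in> carrier E"
    then obtain u where "z = \<iota> u"
      by (auto simp: carrier_coordinate_space)
    with z show "cinner E z (\<iota> v \<ominus>\<^bsub>E\<^esub> \<iota> w) = cinner E z (\<iota> (\<lambda>i. v i - w i))"
      by (simp add: E.cinner_minus_right coordinate_space_simps algebra_simps sum_subtractf)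
  qed auto
  then show ?thesis
    by (simp add: hdist_def hnorm_coordinate_space)
qed

text \<open>Each coordinate of a Cauchy sequence is Cauchy in the complex numbers. The
  coordinatewise limit is a limit in norm because \<open>L2_set\<close> over finitely many
  coordinates is continuous.\<close>

lemma hilbert_space_coordinate_space: "hilbert_space E"
proof
  show "E.hmetric.mcomplete"
    unfolding E.hmetric.mcomplete_def
  proof (intro allI impI)
    fix s assume s: "E.hmetric.MCauchy s"
    then have "range s \<subseteq> carrier E"
      unfolding E.hmetric.MCauchy_def by blast
    then have "\<forall>k. \<exists>v\<in>finite_support_below n. s k = \<iota> v"
      unfolding carrier_coordinate_space by blast
    then obtain v where v: "\<And>k. v k \<in> finite_support_below n" "\<And>k. s k = \<iota> (v k)"
      by metis
    have "Cauchy (\<lambda>k. v k i)" for i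
    proof (cases "i < n")
      case True
      show ?thesis
        unfolding Cauchy_def dist_norm
      proof (intro allI impI)
        fix \<epsilon> :: real assume "\<epsilon> > 0"
        then obtain N where N: "\<And>k l. N \<le> k \<Longrightarrow> N \<le> l \<Longrightarrow> hdist E (s k) (s l) < \<epsilon>"
          using s unfolding E.hmetric.MCauchy_def by blast
        have "cmod (v k i - v l i) < \<epsilon>" if "N \<le> k" "N \<le> l" for k l
          using N[OF that] member_le_L2_set[of "{..<n}" i "\<lambda>i. cmod (v k i - v l i)"] True v
          by (simp add: hdist_coordinate_space)
        then show "\<exists>M. \<forall>k\<ge>M. \<forall>l\<ge>M. cmod (v k i - v l i) < \<epsilon>"
          by blast
      qed
    next
      case False
      then have "(\<lambda>k. v k i) = (\<lambda>k. 0)"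
        using v(1) by (auto simp: finite_support_below_def)
      then show ?thesis by (simp add: Cauchy_def)
    qed
    then have "\<forall>i. \<exists>l. (\<lambda>k. v k i) \<longlonglongrightarrow> l"
      using Cauchy_convergent convergent_def by blast
    then obtain w where w: "\<And>i. (\<lambda>k. v k i) \<longlonglongrightarrow> w i"
      by metis
    have w_in: "w \<in> finite_support_below n"
      unfolding finite_support_below_def
    proof (intro CollectI allI impI)
      fix i assume "n \<le> i"
      then have "(\<lambda>k. v k i) = (\<lambda>k. 0)"
        using v(1) by (auto simp: finite_support_below_def)
      then show "w i = 0"
        using w[of i] LIMSEQ_unique[OF _ tendsto_const] by metis
    qed
    have "(\<lambda>k. L2_set (\<lambda>i. cmod (v k i - w i)) {..<n}) \<longlonglongrightarrow> L2_set (\<lambda>i. cmod (w i - w i)) {..<n}"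
      unfolding L2_set_def by (intro tendsto_intros w)
    then have "(\<lambda>k. hdist E (s k) (\<iota> w)) \<longlonglongrightarrow> 0"
      using v w_in by (simp add: hdist_coordinate_space L2_set_def)
    then have "limitin E.hmetric.mtopology s (\<iota> w) sequentially"
      unfolding E.hmetric.limit_metric_sequentially
      using v w_in by (auto simp: carrier_coordinate_space LIMSEQ_iff)
    then show "\<exists>x. limitin E.hmetric.mtopology s x sequentially" ..
  qed
qed

text \<open>Vectors whose first \<open>n\<close> coordinates lie in a countable dense set of complex
  numbers form a countable dense subset.\<close>

lemma separable_hilbert_space_coordinate_space: "separable_hilbert_space E"
proof (intro separable_hilbert_space.intro separable_hilbert_space_axioms.intro)
  show "hilbert_space E"
    by (rule hilbert_space_coordinate_space)
  obtain D :: "complex set" where D: "countable D" "\<forall>U. open U \<longrightarrow> U \<noteq> {} \<longrightarrow> (\<exists>d\<in>D. d \<in> U)"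
    using countable_dense_exists[where 'a = complex] by blast
  define P where "P = (\<lambda>f i. if i < n then f i else 0) ` (\<Pi>\<^sub>E i\<in>{..<n}. D)"
  have P_in: "P \<subseteq> finite_support_below n"
    unfolding P_def finite_support_below_def by (rule image_subsetI) simp
  have "countable P"
    unfolding P_def using D(1) by (intro countable_image countable_PiE) auto
  moreover have "\<iota> ` P \<subseteq> carrier E"
    using P_in by (auto simp: carrier_coordinate_space)
  moreover have "carrier E \<subseteq> E.hmetric.mtopology closure_of (\<iota> ` P)"
  proof
    fix x assume x: "x \<in> carrier E"
    then obtain v where v: "v \<in> finite_support_below n" "x = \<iota> v"
      by (auto simp: carrier_coordinate_space)
    have "\<exists>y\<in>\<iota> ` P. y \<in> E.hmetric.mball x r" if "r > 0" for r
    proof -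
      \<comment> \<open>Here \<open>n\<close> errors below \<open>r / Suc n\<close> add up to less
        than \<open>r\<close>; using \<open>Suc n\<close> also covers dimension zero.\<close>
      have "r / Suc n > 0"
        using \<open>r > 0\<close> by (intro divide_pos_pos) auto
      then have "\<forall>i. \<exists>d\<in>D. d \<in> ball (v i) (r / Suc n)"
        by (intro allI D(2)[rule_format]) (simp_all del: of_nat_Suc)
      then obtain f where f: "\<And>i. f i \<in> D" "\<And>i. cmod (v i - f i) < r / Suc n"
        unfolding mem_ball dist_norm by metis
      define w where "w = (\<lambda>i. if i < n then f i else 0)"
      have "w \<in> P"
        unfolding P_def w_def using f(1)
        by (intro image_eqI[of _ _ "restrict f {..<n}"]) auto
      then have w: "w \<in> finite_support_below n" "\<iota> w \<in> carrier E"
        using P_in by (auto simp: carrier_coordinate_space)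
      have "hdist E x (\<iota> w) \<le> (\<Sum>i<n. cmod (v i - w i))"
        unfolding v(2) hdist_coordinate_space[OF v(1) w(1)] by (intro L2_set_le_sum) auto
      also have "\<dots> \<le> (\<Sum>i<n. r / Suc n)"
        using f(2) by (intro sum_mono) (auto simp: w_def intro: less_imp_le)
      also have "\<dots> < r"
        using \<open>r > 0\<close> by (simp add: field_simps)
      finally show ?thesis
        using \<open>w \<in> P\<close> w x by (intro bexI[of _ "\<iota> w"]) auto
    qed
    then show "x \<in> E.hmetric.mtopology closure_of (\<iota> ` P)"
      using x by (simp add: E.hmetric.metric_closure_of)
  qed
  ultimately show "separable_space E.hmetric.mtopology"
    unfolding separable_space_def
    by (intro exI[of _ "\<iota> ` P"])
      (auto simp: closure_of_subset_topspace[of E.hmetric.mtopology, simplified] antisym)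
qed

end

section \<open>Amenability from positive definite approximants\<close>

text \<open>The part of the relation between \<open>\<psi>\<close> at an inverse and the adjoint of
  \<open>\<psi>\<close> that is used later. It comes from the fact that the sums in positive
  definiteness are real.\<close>

lemma (in complex_inner_space) positive_definite_symmetric:
  assumes G: "group G" and \<psi>: "\<psi> \<in> carrier G \<rightarrow> bounded_operators H"
    and pd: "positive_definite G H \<psi>"
    and x: "x \<in> carrier G" and [simp]: "\<xi> \<in> carrier H" "\<eta> \<in> carrier H"
  shows "Re (cinner H (\<psi> (inv\<^bsub>G\<^esub> x) \<xi>) \<eta>) = Re (cinner H (\<psi> x \<eta>) \<xi>)"
proof -
  interpret G: group G by (rule G)
  have op: "\<psi> g \<in> bounded_operators H" if "g \<in> carrier G" for g
    using \<psi> that by blast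
  note [simp] = bounded_operator_closed[OF op]
  have pd_sum: "0 \<le> (\<Sum>i=1..n. \<Sum>j=1..n. cinner H (\<psi> (inv\<^bsub>G\<^esub> (g i) \<otimes>\<^bsub>G\<^esub> g j) (v j)) (v i))"
    if "n \<ge> 1" "g \<in> {1..n} \<rightarrow> carrier G" "v \<in> {1..n} \<rightarrow> carrier H" for n :: nat and g v
    using pd that unfolding positive_definite_def by blast
  have diag: "Im (cinner H (\<psi> \<one>\<^bsub>G\<^esub> \<zeta>) \<zeta>) = 0" if "\<zeta> \<in> carrier H" for \<zeta>
    using pd_sum[of 1 "\<lambda>_. \<one>\<^bsub>G\<^esub>" "\<lambda>_. \<zeta>"] that by (simp add: less_eq_complex_def)
  \<comment> \<open>Positive definiteness at the two points 1 and \<open>x\<close> with vectors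
    \<open>\<xi>\<close> and \<open>\<zeta>\<close>: the diagonal terms are real, so the imaginary
    parts of the off-diagonal ones cancel. Taking \<open>\<i> \<odot> \<eta>\<close> for
    \<open>\<zeta>\<close> then converts imaginary into real parts.\<close>
  have pair: "Im (cinner H (\<psi> x \<zeta>) \<xi>) = - Im (cinner H (\<psi> (inv\<^bsub>G\<^esub> x) \<xi>) \<zeta>)"
    if [simp]: "\<zeta> \<in> carrier H" for \<zeta>
  proof -
    define g where "g i = (if i = Suc 0 then \<one>\<^bsub>G\<^esub> else x)" for i
    define v where "v i = (if i = Suc 0 then \<xi> else \<zeta>)" for i
    have "g \<in> {1..2} \<rightarrow> carrier G" "v \<in> {1..2} \<rightarrow> carrier H"
      using x by (auto simp: g_def v_def)
    then have "0 \<le> (\<Sum>i=1..2. \<Sum>j=1..2. cinner H (\<psi> (inv\<^bsub>G\<^esub> (g i) \<otimes>\<^bsub>G\<^esub> g j) (v j)) (v i))"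
      by (intro pd_sum) auto
    moreover have "{1..2::nat} = {1, 2}"
      by auto
    ultimately show ?thesis
      using diag[of \<xi>] diag[of \<zeta>] x by (simp add: g_def v_def less_eq_complex_def)
  qed
  have "Im (cinner H (\<psi> x (\<i> \<odot> \<eta>)) \<xi>) = Re (cinner H (\<psi> x \<eta>) \<xi>)"
    using x by (simp add: bounded_operator_smult[OF op] cinner_smult_left)
  moreover have "Im (cinner H (\<psi> (inv\<^bsub>G\<^esub> x) \<xi>) (\<i> \<odot> \<eta>)) = - Re (cinner H (\<psi> (inv\<^bsub>G\<^esub> x) \<xi>) \<eta>)"
    using x by (simp add: cinner_smult_right)
  ultimately show ?thesis
    using pair[of "\<i> \<odot> \<eta>"] by simp
qed

text \<open>The competitor \<open>\<zeta> = b + t w\<close> with small \<open>t > 0\<close> shows that \<open>Re \<langle>a y - b, w\<rangle>\<close>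
  cannot be bounded below by a positive constant.\<close>

lemma (in complex_inner_space) small_inner_product_if_near:
  fixes a :: "'g \<Rightarrow> 'g \<Rightarrow> 'h \<Rightarrow> 'h" and b :: "'g \<Rightarrow> 'h \<Rightarrow> 'h"
  assumes near: "\<And>F (n::nat) \<xi> \<zeta>. \<lbrakk>F \<subseteq> A; finite F; n \<ge> 1;
        \<forall>i\<in>{1..n}. \<xi> i \<in> F \<rightarrow> carrier H \<and> \<zeta> i \<in> F \<rightarrow> carrier H\<rbrakk> \<Longrightarrow>
      \<exists>y\<in>Y. (\<Sum>i=1..n. \<Sum>x\<in>F. (hnorm H (a x y (\<xi> i x) \<ominus> b x (\<xi> i x)))\<^sup>2)
        \<le> (\<Sum>i=1..n. \<Sum>x\<in>F. (hnorm H (a x y (\<xi> i x) \<ominus> \<zeta> i x))\<^sup>2)"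
    and a_in: "\<And>x y \<xi>. x \<in> A \<Longrightarrow> y \<in> Y \<Longrightarrow> \<xi> \<in> carrier H \<Longrightarrow> a x y \<xi> \<in> carrier H"
    and b_in: "\<And>x \<xi>. x \<in> A \<Longrightarrow> \<xi> \<in> carrier H \<Longrightarrow> b x \<xi> \<in> carrier H"
    and I: "finite I" "I \<noteq> {}"
    and vec: "\<And>i. i \<in> I \<Longrightarrow> x i \<in> A" "\<And>i. i \<in> I \<Longrightarrow> \<xi> i \<in> carrier H" "\<And>i. i \<in> I \<Longrightarrow> w i \<in> carrier H"
    and \<epsilon>: "\<epsilon> > 0"
  obtains y where "y \<in> Y" "(\<Sum>i\<in>I. Re (cinner H (a (x i) y (\<xi> i) \<ominus> b (x i) (\<xi> i)) (w i))) \<le> \<epsilon>"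
proof -
  define n where "n = card I"
  have n: "n \<ge> 1"
    using I by (simp add: n_def Suc_leI card_gt_0_iff)
  obtain e where e: "bij_betw e {1..n} I"
    unfolding n_def using ex_bij_betw_nat_finite_1[OF I(1)] by blast
  have e_in: "e j \<in> I" if "j \<in> {1..n}" for j
    using e that by (auto simp: bij_betw_def)
  define W where "W = (\<Sum>i\<in>I. (hnorm H (w i))\<^sup>2)"
  \<comment> \<open>Small enough for \<open>t * W \<le> \<epsilon>\<close>; the summand 1 covers
    \<open>W = 0\<close>.\<close>
  define t where "t = \<epsilon> / (W + 1)"
  have "W \<ge> 0"
    by (simp add: W_def sum_nonneg)
  then have t: "t > 0" "t * W \<le> \<epsilon>"
    using \<epsilon> by (auto simp: t_def field_simps)
  define F where "F = x ` I"
  \<comment> \<open>Each index gets its own row, since \<open>x\<close> need not be injective. In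
    row \<open>j\<close> the vector is constant, and the competitor \<open>Z\<close> differs from
    \<open>b\<close> only at the point \<open>x (e j)\<close>, so all other points cancel.\<close>
  define \<Xi> where "\<Xi> = (\<lambda>j (z::'g). \<xi> (e j))"
  define Z where "Z = (\<lambda>j z. if z = x (e j) then b z (\<xi> (e j)) \<oplus> of_real t \<odot> w (e j) else b z (\<xi> (e j)))"
  have FA: "F \<subseteq> A" "finite F"
    using vec(1) I(1) by (auto simp: F_def)
  have "\<forall>j\<in>{1..n}. \<Xi> j \<in> F \<rightarrow> carrier H \<and> Z j \<in> F \<rightarrow> carrier H"
    using e_in vec b_in FA(1) by (auto simp: \<Xi>_def Z_def)
  from near[OF FA n this] obtain y where y: "y \<in> Y"
    "(\<Sum>j=1..n. \<Sum>z\<in>F. (hnorm H (a z y (\<Xi> j z) \<ominus> b z (\<Xi> j z)))\<^sup>2)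
      \<le> (\<Sum>j=1..n. \<Sum>z\<in>F. (hnorm H (a z y (\<Xi> j z) \<ominus> Z j z))\<^sup>2)"
    by blast
  define \<delta> where "\<delta> i = a (x i) y (\<xi> i) \<ominus> b (x i) (\<xi> i)" for i
  have row: "(\<Sum>z\<in>F. (hnorm H (a z y (\<Xi> j z) \<ominus> b z (\<Xi> j z)))\<^sup>2) - (\<Sum>z\<in>F. (hnorm H (a z y (\<Xi> j z) \<ominus> Z j z))\<^sup>2)
      = 2 * t * Re (cinner H (\<delta> (e j)) (w (e j))) - t\<^sup>2 * (hnorm H (w (e j)))\<^sup>2"
    if j: "j \<in> {1..n}" for j
  proof -
    define i where "i = e j"
    have i: "i \<in> I" "x i \<in> F"
      using e_in[OF j] by (auto simp: i_def F_def)
    have [simp]: "x i \<in> A" "\<xi> i \<in> carrier H" "w i \<in> carrier H"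
      using vec i by auto
    have [simp]: "a (x i) y (\<xi> i) \<in> carrier H" "b (x i) (\<xi> i) \<in> carrier H"
      using a_in b_in y(1) by auto
    have "(\<Sum>z\<in>F. (hnorm H (a z y (\<Xi> j z) \<ominus> b z (\<Xi> j z)))\<^sup>2) - (\<Sum>z\<in>F. (hnorm H (a z y (\<Xi> j z) \<ominus> Z j z))\<^sup>2)
      = (\<Sum>z\<in>F. if z = x i then (hnorm H (\<delta> i))\<^sup>2 - (hnorm H (a z y (\<Xi> j z) \<ominus> Z j z))\<^sup>2 else 0)"
      unfolding sum_subtractf[symmetric] by (intro sum.cong refl) (auto simp: \<delta>_def Z_def \<Xi>_def i_def)
    also have "\<dots> = (hnorm H (\<delta> i))\<^sup>2 - (hnorm H (a (x i) y (\<Xi> j (x i)) \<ominus> Z j (x i)))\<^sup>2"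
      using i(2) FA(2) by simp
    also have "a (x i) y (\<Xi> j (x i)) \<ominus> Z j (x i) = \<delta> i \<ominus> of_real t \<odot> w i"
      by (rule cinner_eqI)
        (simp_all add: \<Xi>_def Z_def \<delta>_def cinner_minus_right cinner_add_right flip: i_def)
    also have "(hnorm H (\<delta> i))\<^sup>2 - (hnorm H (\<delta> i \<ominus> of_real t \<odot> w i))\<^sup>2
        = 2 * t * Re (cinner H (\<delta> i) (w i)) - t\<^sup>2 * (hnorm H (w i))\<^sup>2"
      by (simp add: \<delta>_def hnorm_minus_power2[of "_ \<ominus> _"] cinner_smult_right hnorm_smult power_mult_distrib)
    finally show ?thesis
      by (simp add: i_def)
  qed
  have "0 \<ge> (\<Sum>j=1..n. 2 * t * Re (cinner H (\<delta> (e j)) (w (e j))) - t\<^sup>2 * (hnorm H (w (e j)))\<^sup>2)"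
    using y(2) by (simp add: row[symmetric] sum_subtractf)
  also have "(\<Sum>j=1..n. 2 * t * Re (cinner H (\<delta> (e j)) (w (e j))) - t\<^sup>2 * (hnorm H (w (e j)))\<^sup>2)
      = (\<Sum>i\<in>I. 2 * t * Re (cinner H (\<delta> i) (w i)) - t\<^sup>2 * (hnorm H (w i))\<^sup>2)"
    by (rule sum.reindex_bij_betw[OF e])
  also have "\<dots> = t * (2 * (\<Sum>i\<in>I. Re (cinner H (\<delta> i) (w i))) - t * W)"
    by (simp add: W_def sum_subtractf sum_distrib_left power2_eq_square algebra_simps)
  finally have "2 * (\<Sum>i\<in>I. Re (cinner H (\<delta> i) (w i))) \<le> t * W"
    using t(1) by (simp add: mult_le_0_iff)
  then have "(\<Sum>i\<in>I. Re (cinner H (\<delta> i) (w i))) \<le> \<epsilon>"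
    using t \<epsilon> by simp
  then show thesis
    using that y(1) by (simp add: \<delta>_def)
qed

text \<open>The rank one operators \<open>\<phi> y = v y \<otimes> e\<^sup>*\<close> satisfy
  \<open>\<phi> (x y) (\<phi> y)\<^sup>* \<xi> = \<langle>\<xi>, v y\<rangle> v (x y)\<close>, whose matrix entries contain both \<open>u k (x y)\<close> and
  \<open>u k y\<close> in transposed positions; the symmetry of \<open>\<psi>\<close> then compares the two.\<close>

lemma (in hilbert_space) coboundary_le_if_approximant:
  fixes G :: "('g, 'm) monoid_scheme" and u :: "nat \<Rightarrow> 'g \<Rightarrow> real" and m :: nat
  assumes G: "group G"
    and approx: "\<forall>\<phi> \<in> carrier G \<rightarrow> bounded_operators H. uniformly_bounded G H \<phi> \<longrightarrow>
        (\<exists>\<psi> \<in> carrier G \<rightarrow> bounded_operators H. positive_definite G H \<psi> \<and>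
          (\<forall>F n \<xi> \<zeta>. F \<subseteq> carrier G \<and> finite F \<and> n \<ge> 1 \<and>
              (\<forall>i\<in>{1..n::nat}. \<xi> i \<in> F \<rightarrow> carrier H \<and> \<zeta> i \<in> F \<rightarrow> carrier H) \<longrightarrow>
            (\<exists>y\<in>carrier G.
              (\<Sum>i=1..n. \<Sum>x\<in>F. (hnorm H
                 (\<phi> (x \<otimes>\<^bsub>G\<^esub> y) (adjoint_op H (\<phi> y) (\<xi> i x)) \<ominus> \<psi> x (\<xi> i x)))\<^sup>2)
              \<le> (\<Sum>i=1..n. \<Sum>x\<in>F. (hnorm H
                 (\<phi> (x \<otimes>\<^bsub>G\<^esub> y) (adjoint_op H (\<phi> y) (\<xi> i x)) \<ominus> \<zeta> i x))\<^sup>2))))"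
    and e: "e \<in> carrier H" "cinner H e e = 1"
    and f: "\<And>k. k < m \<Longrightarrow> f k \<in> carrier H"
    and v: "\<And>y. y \<in> carrier G \<Longrightarrow> v y \<in> carrier H" "\<And>y. y \<in> carrier G \<Longrightarrow> hnorm H (v y) \<le> B"
    and v_e: "\<And>y. y \<in> carrier G \<Longrightarrow> cinner H (v y) e = 1"
    and v_f: "\<And>y k. y \<in> carrier G \<Longrightarrow> k < m \<Longrightarrow> cinner H (v y) (f k) = of_real (u k y)"
    and s: "\<And>k. k < m \<Longrightarrow> s k \<in> carrier G"
    and \<epsilon>: "\<epsilon> > 0"
  shows "\<exists>y\<in>carrier G. (\<Sum>k<m. u k (s k \<otimes>\<^bsub>G\<^esub> y) - u k y) \<le> \<epsilon>"
\<comment> \<open>The empty sum is treated apart because the index set \<open>I\<close> below has to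
  be nonempty.\<close>
proof (cases "m = 0")
  case True
  interpret G: group G by (rule G)
  show ?thesis
    using True \<epsilon> by (intro bexI[of _ "\<one>\<^bsub>G\<^esub>"]) auto
next
  case False
  interpret G: group G by (rule G)
  note [simp] = e(1) v(1)
  have norm_e: "hnorm H e = 1"
    using e by (simp add: hnorm_def)
  define \<phi> where "\<phi> y = (\<lambda>\<xi>\<in>carrier H. cinner H \<xi> e \<odot> v y)" for y
  have \<phi>_norm: "hnorm H (\<phi> y \<xi>) \<le> B * hnorm H \<xi>" if y: "y \<in> carrier G" and \<xi>: "\<xi> \<in> carrier H" for y \<xi>
  proof -
    have "hnorm H (\<phi> y \<xi>) = cmod (cinner H \<xi> e) * hnorm H (v y)"
      using y \<xi> by (simp add: \<phi>_def hnorm_smult)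
    also have "\<dots> \<le> hnorm H \<xi> * B"
      using cinner_Cauchy_Schwarz[OF \<xi> e(1)] v(2)[OF y] y \<xi> by (intro mult_mono) (auto simp: norm_e)
    finally show ?thesis
      by (simp add: mult.commute)
  qed
  have \<phi>_op: "\<phi> y \<in> bounded_operators H" if y: "y \<in> carrier G" for y
  proof -
    have mem: "\<phi> y \<in> carrier H \<rightarrow>\<^sub>E carrier H"
      using y by (auto simp: \<phi>_def)
    have add: "\<phi> y (\<xi> \<oplus> \<eta>) = \<phi> y \<xi> \<oplus> \<phi> y \<eta>" if "\<xi> \<in> carrier H" "\<eta> \<in> carrier H" for \<xi> \<eta>
      using that y smult_l_distr[of "cinner H \<xi> e" "cinner H \<eta> e" "v y"]
      by (simp add: \<phi>_def cinner_add_left)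
    have smult: "\<phi> y (c \<odot> \<xi>) = c \<odot> \<phi> y \<xi>" if "\<xi> \<in> carrier H" for c \<xi>
      using that y smult_assoc1[of c "cinner H \<xi> e" "v y"]
      by (simp add: \<phi>_def cinner_smult_left)
    show ?thesis
      unfolding bounded_operators_def
      by (intro CollectI conjI ballI allI exI[of _ B] mem add smult \<phi>_norm y)
  qed
  have "operator_norm H (\<phi> y) \<le> B" if y: "y \<in> carrier G" for y
    unfolding operator_norm_def
  proof (rule cSUP_least)
    show "{x \<in> carrier H. hnorm H x \<le> 1} \<noteq> {}"
      using norm_e by (auto intro!: exI[of _ e])
    have "0 \<le> B"
      using v[OF y] hnorm_nonneg[of "v y"] by (meson order_trans)
    fix \<xi> assume "\<xi> \<in> {x \<in> carrier H. hnorm H x \<le> 1}"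
    then have \<xi>: "\<xi> \<in> carrier H" "hnorm H \<xi> \<le> 1"
      by auto
    show "hnorm H (\<phi> y \<xi>) \<le> B"
      using \<phi>_norm[OF y \<xi>(1)] mult_left_mono[OF \<xi>(2) \<open>0 \<le> B\<close>] by simp
  qed
  then have "uniformly_bounded G H \<phi>"
    unfolding uniformly_bounded_def by (intro bdd_aboveI[of _ B]) auto
  moreover have "\<phi> \<in> carrier G \<rightarrow> bounded_operators H"
    using \<phi>_op by blast
  ultimately obtain \<psi> where \<psi>: "\<psi> \<in> carrier G \<rightarrow> bounded_operators H" "positive_definite G H \<psi>"
    and near: "\<forall>F n \<xi> \<zeta>. F \<subseteq> carrier G \<and> finite F \<and> n \<ge> 1 \<and>
              (\<forall>i\<in>{1..n::nat}. \<xi> i \<in> F \<rightarrow> carrier H \<and> \<zeta> i \<in> F \<rightarrow> carrier H) \<longrightarrow>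
            (\<exists>y\<in>carrier G.
              (\<Sum>i=1..n. \<Sum>x\<in>F. (hnorm H
                 (\<phi> (x \<otimes>\<^bsub>G\<^esub> y) (adjoint_op H (\<phi> y) (\<xi> i x)) \<ominus> \<psi> x (\<xi> i x)))\<^sup>2)
              \<le> (\<Sum>i=1..n. \<Sum>x\<in>F. (hnorm H
                 (\<phi> (x \<otimes>\<^bsub>G\<^esub> y) (adjoint_op H (\<phi> y) (\<xi> i x)) \<ominus> \<zeta> i x))\<^sup>2))"
    using approx by blast
  have \<psi>_in [simp]: "\<psi> x \<xi> \<in> carrier H" if "x \<in> carrier G" "\<xi> \<in> carrier H" for x \<xi>
    using \<psi>(1) that by blast
  have adj: "adjoint_op H (\<phi> y) \<xi> = cinner H \<xi> (v y) \<odot> e" if "y \<in> carrier G" "\<xi> \<in> carrier H" for y \<xi>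
    using that cinner_commute[of "v y" \<xi>]
    by (intro adjoint_op_eqI) (auto simp: \<phi>_def cinner_smult_left cinner_smult_right)
  define a where "a x y \<xi> = \<phi> (x \<otimes>\<^bsub>G\<^esub> y) (adjoint_op H (\<phi> y) \<xi>)" for x y \<xi>
  have a_eq: "a x y \<xi> = cinner H \<xi> (v y) \<odot> v (x \<otimes>\<^bsub>G\<^esub> y)"
    if "x \<in> carrier G" "y \<in> carrier G" "\<xi> \<in> carrier H" for x y \<xi>
    using that e(2) by (simp add: a_def adj) (simp add: \<phi>_def cinner_smult_left)
  have a_in [simp]: "a x y \<xi> \<in> carrier H"
    if "x \<in> carrier G" "y \<in> carrier G" "\<xi> \<in> carrier H" for x y \<xi>
    using that by (simp add: a_eq)
  \<comment> \<open>For each \<open>k\<close> two matrix entries are tested: \<open>True\<close>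
    contributes \<open>u k (s k \<otimes> y)\<close> and \<open>False\<close>, through the vector
    \<open>- e\<close>, contributes \<open>- u k y\<close>. The two entries of \<open>\<psi>\<close>
    cancel by \<open>positive_definite_symmetric\<close>.\<close>
  define I where "I = {..<m} \<times> (UNIV :: bool set)"
  define x where "x = (\<lambda>(k, p). if p then s k else inv\<^bsub>G\<^esub> (s k))"
  define \<xi> where "\<xi> = (\<lambda>(k, p). if p then e else f k)"
  define w where "w = (\<lambda>(k, p). if p then f k else (- 1) \<odot> e)"
  obtain y where y: "y \<in> carrier G"
    "(\<Sum>i\<in>I. Re (cinner H (a (x i) y (\<xi> i) \<ominus> \<psi> (x i) (\<xi> i)) (w i))) \<le> \<epsilon>"
  proof (rule small_inner_product_if_near[of "carrier G" "carrier G" a \<psi> I x \<xi> w \<epsilon>])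
    show "finite I" "I \<noteq> {}"
      using False by (auto simp: I_def)
    show "x i \<in> carrier G" "\<xi> i \<in> carrier H" "w i \<in> carrier H" if "i \<in> I" for i
      using that s f by (auto simp: I_def x_def \<xi>_def w_def)
    show "\<exists>y\<in>carrier G. (\<Sum>i=1..n. \<Sum>x\<in>F. (hnorm H (a x y (\<xi> i x) \<ominus> \<psi> x (\<xi> i x)))\<^sup>2)
        \<le> (\<Sum>i=1..n. \<Sum>x\<in>F. (hnorm H (a x y (\<xi> i x) \<ominus> \<zeta> i x))\<^sup>2)"
      if "F \<subseteq> carrier G" "finite F" "n \<ge> 1"
        "\<forall>i\<in>{1..n}. \<xi> i \<in> F \<rightarrow> carrier H \<and> \<zeta> i \<in> F \<rightarrow> carrier H" for F and n :: nat and \<xi> \<zeta>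
      unfolding a_def using near that by blast
  qed (use \<epsilon> that in auto)
  have pair: "(\<Sum>p\<in>UNIV. Re (cinner H (a (x (k, p)) y (\<xi> (k, p)) \<ominus> \<psi> (x (k, p)) (\<xi> (k, p))) (w (k, p))))
      = u k (s k \<otimes>\<^bsub>G\<^esub> y) - u k y" if k: "k < m" for k
  proof -
    note [simp] = s[OF k] f[OF k] y(1)
    have fv: "cinner H (f k) (v y) = of_real (u k y)"
      using cinner_commute[of "f k" "v y"] v_f[OF y(1) k] by simp
    have ev: "cinner H e (v y) = 1"
      using cinner_commute[of e "v y"] v_e[OF y(1)] by simp
    have "Re (cinner H (a (s k) y e \<ominus> \<psi> (s k) e) (f k)) = u k (s k \<otimes>\<^bsub>G\<^esub> y) - Re (cinner H (\<psi> (s k) e) (f k))"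
      using k by (simp add: a_eq cinner_minus_left cinner_smult_left ev v_f)
    moreover have "Re (cinner H (a (inv\<^bsub>G\<^esub> (s k)) y (f k) \<ominus> \<psi> (inv\<^bsub>G\<^esub> (s k)) (f k)) ((- 1) \<odot> e))
        = - u k y + Re (cinner H (\<psi> (inv\<^bsub>G\<^esub> (s k)) (f k)) e)"
      by (simp add: a_eq cinner_minus_left cinner_smult_left cinner_smult_right fv v_e)
    moreover have "Re (cinner H (\<psi> (inv\<^bsub>G\<^esub> (s k)) (f k)) e) = Re (cinner H (\<psi> (s k) e) (f k))"
      by (rule positive_definite_symmetric[OF G \<psi>]) auto
    ultimately show ?thesis
      by (simp add: UNIV_bool x_def \<xi>_def w_def)
  qed
  have "(\<Sum>i\<in>I. Re (cinner H (a (x i) y (\<xi> i) \<ominus> \<psi> (x i) (\<xi> i)) (w i)))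
      = (\<Sum>k<m. \<Sum>p\<in>UNIV. Re (cinner H (a (x (k, p)) y (\<xi> (k, p)) \<ominus> \<psi> (x (k, p)) (\<xi> (k, p))) (w (k, p))))"
    unfolding I_def by (simp add: sum.cartesian_product split_def)
  also have "\<dots> = (\<Sum>k<m. u k (s k \<otimes>\<^bsub>G\<^esub> y) - u k y)"
    using pair by (intro sum.cong refl) simp
  finally show ?thesis
    using y by auto
qed

section \<open>The equivalence\<close>

theorem theorem1p4:
  fixes G :: "('g, 'm) monoid_scheme"
  assumes "group G"
    and "countable (carrier G)"
    and universe: "(UNIV :: (nat \<Rightarrow> complex) set) \<lesssim> (UNIV :: 'h set)"
  shows "amenable G \<longleftrightarrow>
    (\<forall>H :: 'h cinner_space. separable_hilbert_space H \<longrightarrow>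
      (\<forall>\<phi> \<in> carrier G \<rightarrow> bounded_operators H. uniformly_bounded G H \<phi> \<longrightarrow>
        (\<exists>\<psi> \<in> carrier G \<rightarrow> bounded_operators H. positive_definite G H \<psi> \<and>
          (\<forall>F n \<xi> \<zeta>. F \<subseteq> carrier G \<and> finite F \<and> n \<ge> 1 \<and>
              (\<forall>i\<in>{1..n::nat}. \<xi> i \<in> F \<rightarrow> carrier H \<and> \<zeta> i \<in> F \<rightarrow> carrier H) \<longrightarrow>
            (\<exists>y\<in>carrier G.
              (\<Sum>i=1..n. \<Sum>x\<in>F. (hnorm H
                 (\<phi> (x \<otimes>\<^bsub>G\<^esub> y) (adjoint_op H (\<phi> y) (\<xi> i x)) \<ominus>\<^bsub>H\<^esub> \<psi> x (\<xi> i x)))\<^sup>2)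
              \<le> (\<Sum>i=1..n. \<Sum>x\<in>F. (hnorm H
                 (\<phi> (x \<otimes>\<^bsub>G\<^esub> y) (adjoint_op H (\<phi> y) (\<xi> i x)) \<ominus>\<^bsub>H\<^esub> \<zeta> i x))\<^sup>2))))))"
    (is "_ \<longleftrightarrow> ?approx")
proof
  interpret G: group G by fact
  assume "amenable G"
  then obtain \<mu> where \<mu>: "state_on_linfinity G \<mu>"
    and inv: "\<And>s f. s \<in> carrier G \<Longrightarrow> f \<in> linfinity G \<Longrightarrow>
      \<mu> (\<lambda>x\<in>carrier G. f (inv\<^bsub>G\<^esub> s \<otimes>\<^bsub>G\<^esub> x)) = \<mu> f"
    unfolding amenable_def by blast
  show ?approx
  proof (intro allI impI ballI)
    fix H :: "'h cinner_space" and \<phi>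
    assume H: "separable_hilbert_space H" and \<phi>: "\<phi> \<in> carrier G \<rightarrow> bounded_operators H"
      "uniformly_bounded G H \<phi>"
    interpret hilbert_space_mean H G \<mu>
      using H \<mu> by (intro hilbert_space_mean.intro separable_hilbert_space.axioms(1) linfinity_state.intro)
    \<comment> \<open>Invariance is given for extensional functions only; \<open>f\<close> and its
      restriction have the same translate on the carrier.\<close>
    have "\<forall>s\<in>carrier G. \<forall>f. bounded_fun f \<longrightarrow> mean (\<lambda>y. f (inv\<^bsub>G\<^esub> s \<otimes>\<^bsub>G\<^esub> y)) = mean f"
    proof (intro ballI allI impI)
      fix s f assume s: "s \<in> carrier G" and f: "bounded_fun f"
      have "(\<lambda>y\<in>carrier G. f (inv\<^bsub>G\<^esub> s \<otimes>\<^bsub>G\<^esub> y)) = (\<lambda>y\<in>carrier G. restrict f (carrier G) (inv\<^bsub>G\<^esub> s \<otimes>\<^bsub>G\<^esub> y))"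
        using s by (intro restrict_ext) simp
      then show "mean (\<lambda>y. f (inv\<^bsub>G\<^esub> s \<otimes>\<^bsub>G\<^esub> y)) = mean f"
        unfolding mean_def using inv[OF s restrict_in_linfinity[OF f]] by simp
    qed
    note approximant = positive_definite_approximant[OF G.group_axioms this \<phi>]
    show "\<exists>\<psi> \<in> carrier G \<rightarrow> bounded_operators H. positive_definite G H \<psi> \<and>
          (\<forall>F n \<xi> \<zeta>. F \<subseteq> carrier G \<and> finite F \<and> n \<ge> 1 \<and>
              (\<forall>i\<in>{1..n::nat}. \<xi> i \<in> F \<rightarrow> carrier H \<and> \<zeta> i \<in> F \<rightarrow> carrier H) \<longrightarrow>
            (\<exists>y\<in>carrier G.
              (\<Sum>i=1..n. \<Sum>x\<in>F. (hnorm H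
                 (\<phi> (x \<otimes>\<^bsub>G\<^esub> y) (adjoint_op H (\<phi> y) (\<xi> i x)) \<ominus>\<^bsub>H\<^esub> \<psi> x (\<xi> i x)))\<^sup>2)
              \<le> (\<Sum>i=1..n. \<Sum>x\<in>F. (hnorm H
                 (\<phi> (x \<otimes>\<^bsub>G\<^esub> y) (adjoint_op H (\<phi> y) (\<xi> i x)) \<ominus>\<^bsub>H\<^esub> \<zeta> i x))\<^sup>2)))"
      using approximant(3) by (intro bexI[OF _ approximant(1)] conjI approximant(2)) blast
  qed
next
  assume approx: ?approx
  \<comment> \<open>The injection places copies of all finite-dimensional Hilbert spaces in
    \<open>'h\<close>, and these already suffice for the Dixmier condition.\<close>
  obtain \<iota> :: "(nat \<Rightarrow> complex) \<Rightarrow> 'h" where inj: "inj \<iota>"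
    using universe unfolding lepoll_def by blast
  show "amenable G"
  proof (rule amenable_if_Dixmier[OF \<open>group G\<close>])
    fix d and \<epsilon> :: real
    assume cob: "d \<in> coboundaries G" and \<epsilon>: "\<epsilon> > 0"
    obtain m :: nat and s and u :: "nat \<Rightarrow> 'g \<Rightarrow> real"
      where su: "\<forall>k<m. s k \<in> carrier G \<and> bounded (u k ` carrier G)"
        and d: "d = (\<lambda>y. \<Sum>k<m. u k (s k \<otimes>\<^bsub>G\<^esub> y) - u k y)"
      using coboundaries_eq_sum[OF cob] by blast
    have "\<forall>k. \<exists>C. k < m \<longrightarrow> (\<forall>y\<in>carrier G. \<bar>u k y\<bar> \<le> C)"
      using su unfolding bounded_iff by (metis imageI real_norm_def)
    then obtain C where C: "\<And>k y. k < m \<Longrightarrow> y \<in> carrier G \<Longrightarrow> \<bar>u k y\<bar> \<le> C k"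
      by metis
    \<comment> \<open>One coordinate more than there are functions: coordinate 0 of
      \<open>v y\<close> is the constant 1, and coordinate \<open>Suc k\<close> holds
      \<open>u k y\<close>.\<close>
    define H where "H = coordinate_space \<iota> (Suc m)"
    define e where "e = \<iota> (\<lambda>i. case i of 0 \<Rightarrow> 1 | Suc j \<Rightarrow> 0)"
    define f where "f k = \<iota> (\<lambda>i. case i of 0 \<Rightarrow> 0 | Suc j \<Rightarrow> if j = k then 1 else 0)" for k
    define v where "v y = \<iota> (\<lambda>i. case i of 0 \<Rightarrow> 1 | Suc k \<Rightarrow> if k < m then of_real (u k y) else 0)" for y
    have H: "separable_hilbert_space H"
      unfolding H_def by (rule separable_hilbert_space_coordinate_space[OF inj])
    then interpret hilbert_space H
      by (rule separable_hilbert_space.axioms(1))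
    note simps = H_def e_def f_def v_def carrier_coordinate_space[OF inj] cinner_coordinate_space[OF inj]
      finite_support_below_def sum.lessThan_Suc_shift
    have "\<exists>y\<in>carrier G. (\<Sum>k<m. u k (s k \<otimes>\<^bsub>G\<^esub> y) - u k y) \<le> \<epsilon>"
    proof (rule coboundary_le_if_approximant[OF \<open>group G\<close> approx[THEN spec, THEN mp, OF H]])
      show "e \<in> carrier H" "cinner H e e = 1"
        by (auto simp: simps simp del: sum.lessThan_Suc split: nat.split)
      show "f k \<in> carrier H" if "k < m" for k
        using that by (auto simp: simps split: nat.split)
      show "v y \<in> carrier H" for y
        by (auto simp: simps split: nat.split)
      show "cinner H (v y) e = 1" for y
        by (simp add: simps del: sum.lessThan_Suc)
      show "cinner H (v y) (f k) = of_real (u k y)" if "k < m" for y k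
        using that by (simp add: simps if_distrib[of cnj] if_distrib[of "\<lambda>z. _ * z"] del: sum.lessThan_Suc cong: if_cong)
      show "hnorm H (v y) \<le> 1 + (\<Sum>k<m. C k)" if y: "y \<in> carrier G" for y
      proof -
        \<comment> \<open>The Euclidean norm is at most the sum of the moduli of the coordinates,
          which the constants \<open>C k\<close> bound uniformly in \<open>y\<close>.\<close>
        have "hnorm H (v y) \<le> (\<Sum>i<Suc m. cmod (case i of 0 \<Rightarrow> 1 | Suc k \<Rightarrow> if k < m then of_real (u k y) else 0))"
          unfolding H_def v_def hnorm_coordinate_space[OF inj] by (intro L2_set_le_sum) auto
        also have "\<dots> = 1 + (\<Sum>k<m. \<bar>u k y\<bar>)"
          by (simp add: sum.lessThan_Suc_shift del: sum.lessThan_Suc)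
        also have "\<dots> \<le> 1 + (\<Sum>k<m. C k)"
          using C y by (intro add_left_mono sum_mono) auto
        finally show ?thesis .
      qed
    qed (use su \<epsilon> in auto)
    then show "\<exists>y\<in>carrier G. d y \<le> \<epsilon>"
      by (simp add: d)
  qed
qed

end
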